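(* Let $d, m \geq 1$ be integers, let $\lambda = (\lambda_1, \dots, \lambda_m)$ be a weight, and let $-\infty \leq p \leq 1/d$. The least constant $C$ such that $$K \leq C \, M_{Q_d(p)}^\lambda \left( \frac{\| g_1 \|_1}{\| f_1 \|_1}, \dots, \frac{\| g_m \|_1}{\| f_m \|_1} \right)$$ holds for all integrable functions $f_1, \dots, f_m, g_1, \dots, g_m \colon \mathbb{R}^d \to \mathbb{R}_{\geq 0}$ with $0 < \| f_i \|_1 < \infty$ for every $i = 1, \dots, m$ is $C = 1$. Here $S = S(f_1) \times \dots \times S(f_m)$ and $$K = \operatorname*{ess\,inf}_{x = (x_1, \dots, x_m) \in S} M_p^\lambda \left( \frac{g_1(z_\lambda(x))}{f_1(x_1)}, \dots, \frac{g_m(z_\lambda(x))}{f_m(x_m)} \right),$$ the essential infimum being with respect to Lebesgue measure on $S$.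
   Context: A weight is a tuple $\lambda = (\lambda_1, \dots, \lambda_m)$ of positive real numbers with $\sum_{i=1}^m \lambda_i = 1$. For a weight $\lambda$ and $-\infty \leq p \leq \infty$, the weighted power mean $M_p^\lambda \colon \mathbb{R}_{\geq 0}^m \to \mathbb{R}_{\geq 0}$ is defined by: $M_0^\lambda(a) = \prod_{i=1}^m a_i^{\lambda_i}$; $M_{-\infty}^\lambda(a) = \min_i a_i$; $M_\infty^\lambda(a) = \max_i a_i$; $M_p^\lambda(a) = 0$ if $-\infty \leq p \leq 0$ and $\prod_{i=1}^m a_i = 0$; and $M_p^\lambda(a) = \left( \sum_{i=1}^m \lambda_i a_i^p \right)^{1/p}$ otherwise. For $x = (x_1, \dots, x_m) \in (\mathbb{R}^d)^m$, $z_\lambda(x) = \sum_{i=1}^m \lambda_i x_i \in \mathbb{R}^d$. For $f \colon \mathbb{R}^d \to \mathbb{R}_{\geq 0}$, $S(f) = \{ x \in \mathbb{R}^d \mid f(x) > 0 \}$, and $\| f \|_1$ is the $L^1$ norm with respect to Lebesgue measure. The power transform $Q_d \colon [-\infty, 1/d] \to [-\infty, \infty]$ is $Q_d(p) = \frac{p}{1 - dp}$ for $-\infty < p < 1/d$, $Q_d(-\infty) = -1/d$, and $Q_d(1/d) = \infty$. *)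

theory Defs
  imports "HOL-Probability.Essential_Supremum"
begin

(* m-tuples are functions on an arbitrary finite index type 'm, and R^d is real ^ 'd with
   d = CARD('d); types are inhabited, so m, d >= 1 holds automatically. *)

definition weight :: "('m::finite \<Rightarrow> real) \<Rightarrow> bool" where
  "weight lam \<longleftrightarrow> (\<forall>i. 0 < lam i) \<and> (\<Sum>i\<in>UNIV. lam i) = 1"

(* Intended for nonnegative a. In the last branch either p > 0 or all a i are positive, so
   powr agrees with the usual real power (0 powr s = 0). *)
definition power_mean :: "('m::finite \<Rightarrow> real) \<Rightarrow> ereal \<Rightarrow> ('m \<Rightarrow> real) \<Rightarrow> real" where
  "power_mean lam p a =
     (if p = 0 then (\<Prod>i\<in>UNIV. a i powr lam i)
      else if p = -\<infinity> then Min (range a)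
      else if p = \<infinity> then Max (range a)
      else if p \<le> 0 \<and> (\<Prod>i\<in>UNIV. a i) = 0 then 0
      else (\<Sum>i\<in>UNIV. lam i * a i powr real_of_ereal p) powr (1 / real_of_ereal p))"

(* Intended for p <= 1 / d. *)
definition power_transform :: "nat \<Rightarrow> ereal \<Rightarrow> ereal" where
  "power_transform d p =
     (if p = -\<infinity> then ereal (- 1 / real d)
      else if p = ereal (1 / real d) then \<infinity>
      else ereal (real_of_ereal p / (1 - real d * real_of_ereal p)))"

(* Points of (R^d)^m are elements of the Euclidean space real ^ 'd ^ 'm, which carries
   the dm-dimensional Lebesgue measure. *)
definition bary :: "('m::finite \<Rightarrow> real) \<Rightarrow> real ^ 'd ^ 'm \<Rightarrow> real ^ 'd" where
  "bary lam x = (\<Sum>i\<in>UNIV. lam i *\<^sub>R (x $ i))"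

definition pos_set :: "('a \<Rightarrow> real) \<Rightarrow> 'a set" where
  "pos_set f = {x. 0 < f x}"

definition pos_prod :: "('m::finite \<Rightarrow> real ^ 'd \<Rightarrow> real) \<Rightarrow> (real ^ 'd ^ 'm) set" where
  "pos_prod f = {x. \<forall>i. x $ i \<in> pos_set (f i)}"

definition L1_norm :: "('a::euclidean_space \<Rightarrow> real) \<Rightarrow> real" where
  "L1_norm f = (\<integral>x. \<bar>f x\<bar> \<partial>lebesgue)"

definition ess_inf :: "'a measure \<Rightarrow> ('a \<Rightarrow> ereal) \<Rightarrow> ereal" where
  "ess_inf M f = Sup {c. AE x in M. c \<le> f x}"

lemma ess_inf_eq_esssup:
  assumes f: "f \<in> borel_measurable M"
  shows "ess_inf M f = - esssup M (\<lambda>x. - f x)"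
proof -
  have m: "(\<lambda>x. - f x) \<in> borel_measurable M" using f by simp
  have *: "{z. AE x in M. - f x \<le> z} = uminus ` {c. AE x in M. c \<le> f x}"
    by (auto simp: image_iff ereal_uminus_le_reorder intro!: exI[of _ "- z" for z])
  show ?thesis
    unfolding ess_inf_def esssup_eq_AE[OF m] * by (simp add: ereal_Inf_uminus_image_eq)
qed

definition is_least :: "'a::order set \<Rightarrow> 'a \<Rightarrow> bool" where
  "is_least A c \<longleftrightarrow> c \<in> A \<and> (\<forall>a\<in>A. c \<le> a)"

end

theory Submission
  imports Defs
begin

text \<open>The upper bound goes by induction on the dimension, since \<open>Q\<^sub>d\<close> is the \<open>d\<close>-fold iterate of \<open>Q\<^sub>1\<close>
  and all the intermediate exponents are at most 1. In dimension one, scale each \<open>f\<^sub>i\<close> to have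
  supremum 1. Where all scaled \<open>f\<^sub>i(x\<^sub>i)\<close> are at least \<open>t\<close>, the function
  \<open>G = M\<^sub>p(g\<^sub>1, \<dots>, g\<^sub>m)\<close>, with the \<open>g\<^sub>i\<close> scaled alike, is at least \<open>K t\<close> at \<open>z\<^sub>\<lambda>(x)\<close>; so by
  the one-dimensional Brunn-Minkowski inequality the superlevel sets of \<open>G\<close> are at least as large as
  the weighted means of those of the \<open>f\<^sub>i\<close>. Integrate over \<open>t\<close>, use that \<open>M\<^sub>p\<close> is concave for
  \<open>p \<le> 1\<close>, and apply Hoelder's inequality.

  The hypothesis holds only almost everywhere. Rounding \<open>f\<^sub>i\<close> down and \<open>g\<^sub>i\<close> up to powers of
  \<open>b > 1\<close> makes the ranges countable; at density points of the level sets the almost-everywhere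
  inequality becomes a pointwise one, with exceptions only on a null set of arguments, and this form
  survives Fubini's theorem.\<close>

subsection \<open>Power means\<close>

text \<open>The Brunn-Minkowski inequality needs nonempty sets. Scaling each \<open>f_i\<close> to
  supremum 1 makes all its level sets with \<open>0 < t < 1\<close> nonempty; for an unbounded
  \<open>f_i\<close> a large height replaces the supremum, at the price of a factor
  \<open>1 - e\<close>. Concavity enters through a supergradient at the vector of scaled integrals
  of the \<open>g_i\<close>: it replaces the mean \<open>G\<close> by a linear combination of the
  \<open>g_i\<close>, which integrates term by term.

  The obstacle is the exceptional null set in the space of m-tuples. The barycentres of a null set
  of tuples, such as the diagonal, can fill the whole space, so these exceptions cannot simply be
  dropped from a sum of level sets. A null set of exceptional barycentres, however, only adds
  measure zero to the superlevel set. Density points move the exceptions from tuples to single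
  arguments; setting each \<open>f_i\<close> to 0 on the exceptional set then leaves only the
  condition on the barycentre. Almost all sections of a null set are null, so this condition passes
  to the partial integrals.\<close>

lemma power_mean_zero: "power_mean lam 0 a = (\<Prod>i\<in>UNIV. a i powr lam i)"
  by (simp add: power_mean_def)

lemma power_mean_MInfty: "power_mean lam (-\<infinity>) a = Min (range a)"
  by (simp add: power_mean_def)

lemma power_mean_PInfty: "power_mean lam \<infinity> a = Max (range a)"
  by (simp add: power_mean_def)

lemma power_mean_pos_exponent:
  "0 < r \<Longrightarrow> power_mean lam (ereal r) a = (\<Sum>i\<in>UNIV. lam i * a i powr r) powr (1 / r)"
  by (simp add: power_mean_def)

lemma power_mean_neg_exponent:
  fixes lam :: "'m::finite \<Rightarrow> real"
  shows "r < 0 \<Longrightarrow> power_mean lam (ereal r) a =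
    (if \<exists>i. a i = 0 then 0 else (\<Sum>i\<in>UNIV. lam i * a i powr r) powr (1 / r))"
  by (auto simp: power_mean_def)

lemma ereal_exponent_cases:
  obtains (MInfty) "q = -\<infinity>" | (PInfty) "q = \<infinity>" | (neg) r where "q = ereal r" "r < 0"
    | (zero) "q = 0" | (pos) r where "q = ereal r" "0 < r"
  by (cases q) (metis ereal_eq_0(1) linorder_neqE_linordered_idom)+

lemma weight_pos: "weight lam \<Longrightarrow> 0 < lam i"
  and weight_nonneg: "weight lam \<Longrightarrow> 0 \<le> lam i"
  and weight_sum: "weight lam \<Longrightarrow> (\<Sum>i\<in>UNIV. lam i) = 1"
  by (auto simp: weight_def less_imp_le)

lemma weighted_sum_pos:
  "weight lam \<Longrightarrow> (\<And>i. 0 < a i) \<Longrightarrow> 0 < (\<Sum>i\<in>UNIV. lam i * (a i::real))"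
  by (intro sum_pos) (auto simp: weight_pos)

lemma power_mean_nonneg:
  fixes a :: "'m::finite \<Rightarrow> real"
  assumes "\<And>i. 0 \<le> a i"
  shows "0 \<le> power_mean lam q a"
proof -
  have "0 \<le> Max (range a)"
    using assms by (meson Max_ge finite_range_imageI finite_class.finite_UNIV finite_imageI order.trans rangeI)
  then show ?thesis
    using assms by (auto simp: power_mean_def prod_nonneg)
qed

lemma power_mean_mono:
  fixes a b :: "'m::finite \<Rightarrow> real"
  assumes w: "weight lam" and a: "\<And>i. 0 \<le> a i" and ab: "\<And>i. a i \<le> b i"
  shows "power_mean lam q a \<le> power_mean lam q b"
proof (cases q rule: ereal_exponent_cases)
  case MInfty
  have "Min (range a) \<le> b i" for i
    using ab[of i] by (meson Min_le finite_class.finite_UNIV finite_imageI order.trans rangeI)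
  then show ?thesis by (auto simp: MInfty power_mean_MInfty)
next
  case PInfty
  have "a i \<le> Max (range b)" for i
    using ab[of i] by (meson Max_ge finite_class.finite_UNIV finite_imageI order.trans rangeI)
  then show ?thesis by (auto simp: PInfty power_mean_PInfty)
next
  case (neg r)
  have b: "0 \<le> b i" for i using a[of i] ab[of i] by linarith
  show ?thesis
  proof (cases "\<exists>i. a i = 0")
    case True
    then show ?thesis
      using power_mean_nonneg[of b lam q] b by (auto simp: neg power_mean_neg_exponent)
  next
    case False
    with a have a': "0 < a i" for i by (metis less_eq_real_def)
    then have b': "0 < b i" for i using ab[of i] by (meson less_le_trans)
    have "(\<Sum>i\<in>UNIV. lam i * b i powr r) \<le> (\<Sum>i\<in>UNIV. lam i * a i powr r)"
      using neg a' ab by (intro sum_mono mult_left_mono powr_mono2') (auto simp: weight_nonneg[OF w])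
    then have "(\<Sum>i\<in>UNIV. lam i * a i powr r) powr (1/r) \<le> (\<Sum>i\<in>UNIV. lam i * b i powr r) powr (1/r)"
      using neg b' by (intro powr_mono2') (auto intro!: weighted_sum_pos[OF w] simp: less_imp_neq[THEN not_sym])
    then show ?thesis
      using a' b' by (auto simp: neg power_mean_neg_exponent less_imp_neq[THEN not_sym])
  qed
next
  case zero
  then show ?thesis
    using a ab by (auto simp: power_mean_zero intro!: prod_mono powr_mono2 weight_nonneg[OF w])
next
  case (pos r)
  then show ?thesis
    using a ab by (auto simp: power_mean_pos_exponent
      intro!: powr_mono2 sum_mono sum_nonneg mult_left_mono mult_nonneg_nonneg weight_nonneg[OF w])
qed

lemma power_mean_scale:
  fixes a :: "'m::finite \<Rightarrow> real"
  assumes w: "weight lam" and c: "0 < c"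
  shows "power_mean lam q (\<lambda>i. c * a i) = c * power_mean lam q a"
proof (cases q rule: ereal_exponent_cases)
  case MInfty
  have "mono (\<lambda>x. c * x)" using c by (auto intro: monoI)
  from mono_Min_commute[OF this, of "range a"] show ?thesis
    by (simp add: MInfty power_mean_MInfty image_image)
next
  case PInfty
  have "mono (\<lambda>x. c * x)" using c by (auto intro: monoI)
  from mono_Max_commute[OF this, of "range a"] show ?thesis
    by (simp add: PInfty power_mean_PInfty image_image)
next
  case (neg r)
  have "(\<Sum>i\<in>UNIV. lam i * (c * a i) powr r) = c powr r * (\<Sum>i\<in>UNIV. lam i * a i powr r)"
    by (simp add: powr_mult sum_distrib_left mult_ac)
  then show ?thesis
    using c neg by (auto simp: power_mean_neg_exponent powr_mult powr_powr)
next
  case zero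
  have "(\<Prod>i\<in>UNIV. (c * a i) powr lam i) = (\<Prod>i\<in>UNIV. c powr lam i) * (\<Prod>i\<in>UNIV. a i powr lam i)"
    by (simp add: powr_mult prod.distrib)
  also have "(\<Prod>i\<in>UNIV. c powr lam i) = c"
    using c by (simp add: powr_sum[symmetric] weight_sum[OF w])
  finally show ?thesis by (simp add: zero power_mean_zero)
next
  case (pos r)
  have "(\<Sum>i\<in>UNIV. lam i * (c * a i) powr r) = c powr r * (\<Sum>i\<in>UNIV. lam i * a i powr r)"
    by (simp add: powr_mult sum_distrib_left mult_ac)
  then show ?thesis
    using c pos by (auto simp: power_mean_pos_exponent powr_mult powr_powr)
qed

lemma power_mean_one:
  assumes "weight lam"
  shows "power_mean lam q (\<lambda>_. 1) = 1"
  using weight_sum[OF assms]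
  by (cases q rule: ereal_exponent_cases)
     (auto simp: power_mean_zero power_mean_pos_exponent power_mean_neg_exponent
       power_mean_MInfty power_mean_PInfty)

lemma power_mean_eq_0:
  fixes a :: "'m::finite \<Rightarrow> real"
  assumes "q \<le> 0" "a i = 0" "\<And>i. 0 \<le> a i"
  shows "power_mean lam q a = 0"
proof (cases q rule: ereal_exponent_cases)
  case MInfty
  have "Min (range a) = 0"
    using assms by (intro Min_eqI) (auto intro: rangeI simp: image_iff intro!: exI[of _ i])
  then show ?thesis by (simp add: MInfty power_mean_MInfty)
next
  case zero
  then show ?thesis using assms by (auto simp: power_mean_zero intro: exI[of _ i])
qed (use assms in \<open>auto simp: power_mean_neg_exponent\<close>)

section \<open>Concavity of power means and Hoelder's inequality\<close>

lemma weighted_Young_real: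
  fixes a b :: real
  assumes "0 < \<alpha>" "\<alpha> < 1" "0 \<le> a" "0 \<le> b"
  shows "a powr \<alpha> * b powr (1 - \<alpha>) \<le> \<alpha> * a + (1 - \<alpha>) * b"
proof (cases "a = 0 \<or> b = 0")
  case False
  then show ?thesis using assms Youngs_inequality_0[of \<alpha> "1 - \<alpha>" a b] by auto
qed (use assms in auto)

text \<open>Dividing by the two sums on the right reduces the claim to the weighted Young inequality
  term by term. If one of these sums is 0, every term on the left vanishes.\<close>

lemma weighted_Hoelder_sum:
  fixes x y :: "'m::finite \<Rightarrow> real"
  assumes \<alpha>: "0 < \<alpha>" "\<alpha> < 1" and l: "\<And>i. 0 < l i" and x: "\<And>i. 0 \<le> x i" and y: "\<And>i. 0 \<le> y i"
  shows "(\<Sum>i\<in>UNIV. l i * (x i powr \<alpha> * y i powr (1 - \<alpha>)))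
    \<le> (\<Sum>i\<in>UNIV. l i * x i) powr \<alpha> * (\<Sum>i\<in>UNIV. l i * y i) powr (1 - \<alpha>)"
proof -
  define X Y where "X = (\<Sum>i\<in>UNIV. l i * x i)" and "Y = (\<Sum>i\<in>UNIV. l i * y i)"
  have nn: "0 \<le> l i * x i" "0 \<le> l i * y i" for i
    using x[of i] y[of i] l[of i] by auto
  have XY: "0 \<le> X" "0 \<le> Y"
    unfolding X_def Y_def by (auto intro!: sum_nonneg nn)
  show ?thesis
  proof (cases "X = 0 \<or> Y = 0")
    case True
    have "x i = 0 \<or> y i = 0" for i
      using True nn less_imp_neq[OF l[of i]] sum_nonneg_eq_0_iff[of UNIV "\<lambda>i. l i * x i"]
        sum_nonneg_eq_0_iff[of UNIV "\<lambda>i. l i * y i"]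
      by (auto simp: X_def Y_def)
    then have "(\<Sum>i\<in>UNIV. l i * (x i powr \<alpha> * y i powr (1 - \<alpha>))) = 0"
      by (intro sum.neutral) auto
    then show ?thesis by auto
  next
    case False
    with XY have p: "0 < X" "0 < Y" by auto
    have "l i * ((x i / X) powr \<alpha> * (y i / Y) powr (1 - \<alpha>)) \<le> \<alpha> * (l i * x i / X) + (1 - \<alpha>) * (l i * y i / Y)" for i
      using weighted_Young_real[OF \<alpha>, of "x i / X" "y i / Y"] x[of i] y[of i] p l[of i]
        mult_left_mono[of _ _ "l i"]
      by (fastforce simp: algebra_simps)
    then have "(\<Sum>i\<in>UNIV. l i * ((x i / X) powr \<alpha> * (y i / Y) powr (1 - \<alpha>)))
      \<le> (\<Sum>i\<in>UNIV. \<alpha> * (l i * x i / X) + (1 - \<alpha>) * (l i * y i / Y))"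
      by (intro sum_mono)
    also have "\<dots> = \<alpha> * (X / X) + (1 - \<alpha>) * (Y / Y)"
      by (simp add: X_def Y_def sum.distrib flip: sum_distrib_left sum_divide_distrib)
    also have "\<dots> = 1" using p by simp
    finally have "(\<Sum>i\<in>UNIV. l i * (x i powr \<alpha> * y i powr (1 - \<alpha>))) / (X powr \<alpha> * Y powr (1 - \<alpha>)) \<le> 1"
      by (simp add: sum_divide_distrib powr_divide)
    then show ?thesis using p by (simp add: X_def Y_def divide_le_eq)
  qed
qed

text \<open>Convexity of \<open>exp\<close> at the points \<open>ln (a i)\<close>; a vanishing
  entry, which has no logarithm, makes the left side 0.\<close>

lemma weighted_arith_geom_mean:
  fixes a :: "'m::finite \<Rightarrow> real"
  assumes w: "weight lam" and a: "\<And>i. 0 \<le> a i"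
  shows "(\<Prod>i\<in>UNIV. a i powr lam i) \<le> (\<Sum>i\<in>UNIV. lam i * a i)"
proof (cases "\<exists>i. a i = 0")
  case True
  then have "(\<Prod>i\<in>UNIV. a i powr lam i) = 0" by auto
  moreover have "0 \<le> (\<Sum>i\<in>UNIV. lam i * a i)"
    using a by (intro sum_nonneg mult_nonneg_nonneg weight_nonneg[OF w]) auto
  ultimately show ?thesis by linarith
next
  case False
  with a have a': "0 < a i" for i by (metis less_eq_real_def)
  have "exp (\<Sum>i\<in>UNIV. lam i * ln (a i)) \<le> (\<Sum>i\<in>UNIV. lam i * exp (ln (a i)))"
    using convex_on_sum[OF _ _ exp_convex weight_sum[OF w], of "\<lambda>i. ln (a i)"]
    by (simp add: weight_nonneg[OF w])
  then show ?thesis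
    using a' by (simp add: exp_sum powr_def less_imp_neq[THEN not_sym])
qed

text \<open>If \<open>b i = 0\<close>, the \<open>i\<close>-th partial derivative at \<open>b\<close> may be infinite, hence the restriction on \<open>u\<close>.\<close>

lemma power_mean_supergradient:
  fixes lam :: "'m::finite \<Rightarrow> real"
  assumes w: "weight lam" and q: "q \<le> 1" and b: "\<And>i. 0 \<le> b i"
  obtains v where "\<And>i. 0 \<le> v i" "(\<Sum>i\<in>UNIV. v i * b i) \<le> power_mean lam q b"
    "\<And>u. \<forall>i. 0 \<le> u i \<Longrightarrow> \<forall>i. b i = 0 \<longrightarrow> u i = 0 \<Longrightarrow> power_mean lam q u \<le> (\<Sum>i\<in>UNIV. v i * u i)"
proof -
  note l = weight_pos[OF w] and l0 = weight_nonneg[OF w]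
  note witness = that
  \<comment> \<open>For \<open>q \<le> 0\<close>, a zero of \<open>b\<close> is also a zero of every
    admissible \<open>u\<close>, so all these means vanish and \<open>v = 0\<close> works.\<close>
  have *: thesis if q0: "q \<le> 0" and b0: "b i = 0" for i
  proof (rule witness[of "\<lambda>_. 0"])
    show "(\<Sum>i\<in>UNIV. 0 * b i) \<le> power_mean lam q b" using power_mean_nonneg[OF b] by simp
    show "power_mean lam q u \<le> (\<Sum>i\<in>UNIV. 0 * u i)"
      if "\<forall>i. 0 \<le> u i" "\<forall>i. b i = 0 \<longrightarrow> u i = 0" for u
      using power_mean_eq_0[OF q0, of u i] that b0 by simp
  qed simp
  show thesis
  proof (cases q rule: ereal_exponent_cases)
    case MInfty
    \<comment> \<open>A coordinate in which \<open>b\<close> is minimal: its projection dominates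
      the minimum everywhere and agrees with it at \<open>b\<close>.\<close>
    have "Min (range b) \<in> range b" by (intro Min_in) auto
    then obtain k where k: "b k = Min (range b)" by (metis rangeE)
    show thesis
    proof (rule that[of "\<lambda>i. if i = k then 1 else 0"])
      show "power_mean lam q u \<le> (\<Sum>i\<in>UNIV. (if i = k then 1 else 0) * u i)" for u
        by (auto simp: MInfty power_mean_MInfty if_distrib[of "\<lambda>x. x * _"] cong: if_cong)
    qed (auto simp: MInfty power_mean_MInfty k if_distrib[of "\<lambda>x. x * _"] cong: if_cong)
  next
    case (neg r)
    show thesis
    proof (cases "\<exists>i. b i = 0")
      case True
      then show thesis using * neg by force
    next
      case False
      with b have b': "0 < b i" for i by (metis less_eq_real_def)
      define Z where "Z = (\<Sum>i\<in>UNIV. lam i * b i powr r)"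
      have Z: "0 < Z" unfolding Z_def using b' by (intro weighted_sum_pos[OF w]) (simp add: less_imp_neq[THEN not_sym])
      \<comment> \<open>The coefficients are the partial derivatives of the mean at
        \<open>b\<close>. Euler's identity for homogeneous functions gives equality in the second
        property.\<close>
      show thesis
      proof (rule that[of "\<lambda>i. Z powr (1/r - 1) * (lam i * b i powr (r - 1))"])
        have "(\<Sum>i\<in>UNIV. Z powr (1/r - 1) * (lam i * b i powr (r - 1)) * b i)
          = Z powr (1/r - 1) * (\<Sum>i\<in>UNIV. lam i * (b i powr (r - 1) * b i))"
          by (simp add: sum_distrib_left mult_ac)
        also have "\<dots> = Z powr (1/r - 1) * (\<Sum>i\<in>UNIV. lam i * b i powr r)"
          using b powr_mult_base[of "b _" "r - 1"] by (simp add: mult.commute)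
        also have "Z powr (1/r - 1) * (\<Sum>i\<in>UNIV. lam i * b i powr r) = Z powr (1/r)"
          using Z powr_mult_base[of Z "1/r - 1"] by (simp add: mult.commute flip: Z_def)
        finally show "(\<Sum>i\<in>UNIV. Z powr (1/r - 1) * (lam i * b i powr (r - 1)) * b i) \<le> power_mean lam q b"
          using False neg by (simp add: power_mean_neg_exponent Z_def)
        fix u :: "'m \<Rightarrow> real" assume "\<forall>i. 0 \<le> u i"
        then have u: "\<And>i. 0 \<le> u i" by blast
        show "power_mean lam q u \<le> (\<Sum>i\<in>UNIV. Z powr (1/r - 1) * (lam i * b i powr (r - 1)) * u i)"
        proof (cases "\<exists>i. u i = 0")
          case True
          then show ?thesis using neg u
            by (auto simp: power_mean_neg_exponent intro!: sum_nonneg mult_nonneg_nonneg l0)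
        next
          case False
          with u have u': "0 < u i" for i by (metis less_eq_real_def)
          define X where "X = (\<Sum>i\<in>UNIV. lam i * u i powr r)"
          define Y where "Y = (\<Sum>i\<in>UNIV. lam i * (b i powr (r - 1) * u i))"
          have X: "0 < X" unfolding X_def using u' by (intro weighted_sum_pos[OF w]) (simp add: less_imp_neq[THEN not_sym])
          have Y: "0 < Y" unfolding Y_def using u' b' by (intro weighted_sum_pos[OF w]) (simp add: less_imp_neq[THEN not_sym])
          \<comment> \<open>For negative \<open>r\<close>, Hoelder's inequality bounds
            \<open>Z\<close> through \<open>X\<close> and \<open>Y\<close>. Writing
            \<open>b^r\<close> as \<open>(u^r)^\<alpha> * (b^(r-1) * u)^(1-\<alpha>)\<close>
            requires \<open>r * \<alpha> + (1 - \<alpha>) = 0\<close>, which determines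
            \<open>\<alpha>\<close>; the final power \<open>1/r\<close> reverses the
            inequality.\<close>
          define \<alpha> where "\<alpha> = 1 / (1 - r)"
          have \<alpha>: "0 < \<alpha>" "\<alpha> < 1" "(r - 1) * (1 - \<alpha>) = r" "r * \<alpha> + (1 - \<alpha>) = 0" "(1 - r) * \<alpha> = 1"
            "(1 - r) * (1 - \<alpha>) = - r"
            using neg by (auto simp: \<alpha>_def field_simps)
          have "(u i powr r) powr \<alpha> * (b i powr (r - 1) * u i) powr (1 - \<alpha>) = b i powr r" for i
          proof -
            have "(u i powr r) powr \<alpha> * (b i powr (r - 1) * u i) powr (1 - \<alpha>)
              = b i powr ((r - 1) * (1 - \<alpha>)) * u i powr (r * \<alpha> + (1 - \<alpha>))"
              by (simp add: powr_mult powr_powr powr_add)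
            then show ?thesis using u'[of i] by (simp only: \<alpha>) simp
          qed
          then have "Z = (\<Sum>i\<in>UNIV. lam i * ((u i powr r) powr \<alpha> * (b i powr (r - 1) * u i) powr (1 - \<alpha>)))"
            by (simp add: Z_def)
          also have "\<dots> \<le> X powr \<alpha> * Y powr (1 - \<alpha>)"
            unfolding X_def Y_def using u b by (intro weighted_Hoelder_sum \<alpha> l) auto
          finally have "Z powr (1 - r) \<le> (X powr \<alpha> * Y powr (1 - \<alpha>)) powr (1 - r)"
            using Z neg by (intro powr_mono2) auto
          also have "\<dots> = X powr ((1 - r) * \<alpha>) * Y powr ((1 - r) * (1 - \<alpha>))"
            by (simp add: powr_mult powr_powr mult.commute)
          also have "\<dots> = X * Y powr (- r)" using X by (simp only: \<alpha>) simp
          finally have "Z powr (1 - r) * Y powr r \<le> X * Y powr (- r) * Y powr r"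
            by (intro mult_right_mono) auto
          also have "\<dots> = X" using Y by (simp add: mult.assoc flip: powr_add)
          finally have "X powr (1/r) \<le> (Z powr (1 - r) * Y powr r) powr (1/r)"
            using neg Z Y by (intro powr_mono2') auto
          also have "\<dots> = Z powr ((1 - r) * (1/r)) * Y"
            using neg Y by (simp add: powr_mult powr_powr)
          also have "(1 - r) * (1/r) = 1/r - 1" using neg by (simp add: field_simps)
          also have "Z powr (1/r - 1) * Y = (\<Sum>i\<in>UNIV. Z powr (1/r - 1) * (lam i * b i powr (r - 1)) * u i)"
            by (simp add: Y_def sum_distrib_left mult_ac)
          finally show ?thesis
            using False neg by (simp add: power_mean_neg_exponent X_def)
        qed
      qed (simp add: l0)
    qed
  next
    case zero
    show thesis
    proof (cases "\<exists>i. b i = 0")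
      case True
      then show thesis using * zero by auto
    next
      case False
      with b have b': "0 < b i" for i by (metis less_eq_real_def)
      let ?P = "power_mean lam 0 b"
      have P: "0 \<le> ?P" using power_mean_nonneg[OF b] .
      \<comment> \<open>The gradient of the geometric mean at \<open>b\<close>; the bound is the
        inequality of arithmetic and geometric means for the ratios
        \<open>u i / b i\<close>.\<close>
      show thesis
      proof (rule that[of "\<lambda>i. ?P * (lam i / b i)"])
        have "(\<Sum>i\<in>UNIV. ?P * (lam i / b i) * b i) = ?P * (\<Sum>i\<in>UNIV. lam i)"
          using False by (simp add: sum_distrib_left)
        then show "(\<Sum>i\<in>UNIV. ?P * (lam i / b i) * b i) \<le> power_mean lam q b"
          by (simp add: weight_sum[OF w] zero)
        fix u :: "'m \<Rightarrow> real" assume "\<forall>i. 0 \<le> u i"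
        then have u: "\<And>i. 0 \<le> u i" by blast
        have "power_mean lam 0 u = ?P * (\<Prod>i\<in>UNIV. (u i / b i) powr lam i)"
          using False by (simp add: power_mean_zero powr_divide prod_dividef)
        also have "\<dots> \<le> ?P * (\<Sum>i\<in>UNIV. lam i * (u i / b i))"
          using u b by (intro mult_left_mono P weighted_arith_geom_mean[OF w]) auto
        finally show "power_mean lam q u \<le> (\<Sum>i\<in>UNIV. ?P * (lam i / b i) * u i)"
          by (simp add: zero sum_distrib_left mult_ac)
      qed (use P l0 b in auto)
    qed
  next
    case (pos r)
    show thesis
    proof (cases "r = 1")
      case True
      show thesis
        by (rule that[of lam]) (use pos True b in \<open>auto simp: power_mean_pos_exponent l0 sum_nonneg\<close>)
    next
      case False
      then have r: "0 < r" "r < 1" using q pos by auto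
      define Z where "Z = (\<Sum>i\<in>UNIV. lam i * b i powr r)"
      have Z: "0 \<le> Z" unfolding Z_def by (intro sum_nonneg) (simp add: l0)
      \<comment> \<open>The same gradient as for negative exponents. Where \<open>b i = 0\<close>
        the derivative may be infinite, but \<open>0 powr s = 0\<close> makes the coefficient 0,
        which suffices as \<open>u i = 0\<close> there.\<close>
      show thesis
      proof (rule that[of "\<lambda>i. Z powr (1/r - 1) * (lam i * b i powr (r - 1))"])
        have "(\<Sum>i\<in>UNIV. Z powr (1/r - 1) * (lam i * b i powr (r - 1)) * b i)
          = Z powr (1/r - 1) * (\<Sum>i\<in>UNIV. lam i * (b i powr (r - 1) * b i))"
          by (simp add: sum_distrib_left mult_ac)
        also have "\<dots> = Z powr (1/r - 1) * (\<Sum>i\<in>UNIV. lam i * b i powr r)"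
          using b powr_mult_base[of "b _" "r - 1"] by (simp add: mult.commute)
        also have "Z powr (1/r - 1) * (\<Sum>i\<in>UNIV. lam i * b i powr r) = Z powr (1/r)"
          using Z powr_mult_base[of Z "1/r - 1"] by (simp add: mult.commute flip: Z_def)
        finally show "(\<Sum>i\<in>UNIV. Z powr (1/r - 1) * (lam i * b i powr (r - 1)) * b i) \<le> power_mean lam q b"
          using pos by (simp add: power_mean_pos_exponent Z_def)
        fix u :: "'m \<Rightarrow> real" assume "\<forall>i. 0 \<le> u i" and "\<forall>i. b i = 0 \<longrightarrow> u i = 0"
        then have u: "\<And>i. 0 \<le> u i" and u0: "\<And>i. b i = 0 \<Longrightarrow> u i = 0" by auto
        define Y where "Y = (\<Sum>i\<in>UNIV. lam i * (b i powr (r - 1) * u i))"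
        have Y: "0 \<le> Y" unfolding Y_def using u by (intro sum_nonneg) (simp add: l0)
        have "u i powr r = (b i powr r) powr (1 - r) * (b i powr (r - 1) * u i) powr (1 - (1 - r))" for i
        proof -
          have "(b i powr r) powr (1 - r) * (b i powr (r - 1) * u i) powr (1 - (1 - r))
            = b i powr (r * (1 - r) + (r - 1) * r) * u i powr r"
            by (simp add: powr_mult powr_powr powr_add)
          also have "r * (1 - r) + (r - 1) * r = 0" by (simp add: algebra_simps)
          finally show ?thesis using u0[of i] by (cases "b i = 0") auto
        qed
        then have "(\<Sum>i\<in>UNIV. lam i * u i powr r)
          = (\<Sum>i\<in>UNIV. lam i * ((b i powr r) powr (1 - r) * (b i powr (r - 1) * u i) powr (1 - (1 - r))))"
          by (intro sum.cong arg_cong2[where f="(*)"] refl)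
        also have "\<dots> \<le> Z powr (1 - r) * Y powr (1 - (1 - r))"
          unfolding Z_def Y_def using r u by (intro weighted_Hoelder_sum l) auto
        finally have "(\<Sum>i\<in>UNIV. lam i * u i powr r) powr (1/r) \<le> (Z powr (1 - r) * Y powr r) powr (1/r)"
          using r by (intro powr_mono2 sum_nonneg) (auto simp: l0)
        also have "\<dots> = Z powr ((1 - r) * (1/r)) * Y"
          using r Y by (simp add: powr_mult powr_powr)
        also have "(1 - r) * (1/r) = 1/r - 1" using r by (simp add: field_simps)
        also have "Z powr (1/r - 1) * Y = (\<Sum>i\<in>UNIV. Z powr (1/r - 1) * (lam i * b i powr (r - 1)) * u i)"
          by (simp add: Y_def sum_distrib_left mult_ac)
        finally show "power_mean lam q u \<le> (\<Sum>i\<in>UNIV. Z powr (1/r - 1) * (lam i * b i powr (r - 1)) * u i)"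
          using pos by (simp add: power_mean_pos_exponent)
      qed (simp add: l0)
    qed
  qed (use q in auto)
qed

text \<open>The source of the power transform: if \<open>s\<close> is the transform of
  \<open>q\<close>, then \<open>1/q = 1/s + 1\<close>, so this is Hoelder's inequality with
  exponents \<open>s\<close> and 1. For \<open>q = -\<infinity>\<close> the transform is -1 and the
  harmonic mean of \<open>a\<close> appears; for \<open>q = 1\<close> it is the maximum; for
  \<open>q = 0\<close> the geometric mean is multiplicative.\<close>

lemma power_mean_Hoelder:
  fixes lam :: "'m::finite \<Rightarrow> real"
  assumes w: "weight lam" and q: "q \<le> 1" and a: "\<And>i. 0 \<le> a i" and y: "\<And>i. 0 < y i"
  shows "power_mean lam q (\<lambda>i. a i * y i) \<le> power_mean lam (power_transform 1 q) a * (\<Sum>i\<in>UNIV. lam i * y i)"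
proof -
  note l = weight_pos[OF w] and l0 = weight_nonneg[OF w]
  define Y where "Y = (\<Sum>i\<in>UNIV. lam i * y i)"
  have Y: "0 < Y" unfolding Y_def by (intro weighted_sum_pos[OF w] y)
  have ay: "0 \<le> a i * y i" for i using a[of i] y[of i] by simp
  have *: ?thesis if q0: "q \<le> 0" and a0: "a i = 0" for i
    using power_mean_eq_0[OF q0, of "\<lambda>i. a i * y i" i] a0 ay power_mean_nonneg[OF a, of lam "power_transform 1 q"] Y
    by (simp add: Y_def)
  show ?thesis
  proof (cases q rule: ereal_exponent_cases)
    case MInfty
    show ?thesis
    proof (cases "\<exists>i. a i = 0")
      case True then show ?thesis using * MInfty by auto
    next
      case False
      with a have a': "0 < a i" for i by (metis less_eq_real_def)
      define c where "c = Min (range (\<lambda>i. a i * y i))"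
      have c0: "0 < c" unfolding c_def using a' y by auto
      have c: "c \<le> a i * y i" for i unfolding c_def by auto
      have R: "0 < (\<Sum>i\<in>UNIV. lam i * (1 / a i))"
        using a' by (intro weighted_sum_pos[OF w]) auto
      have "(\<Sum>i\<in>UNIV. lam i * (1 / a i)) \<le> (\<Sum>i\<in>UNIV. lam i * (y i / c))"
        using c c0 a' by (intro sum_mono mult_left_mono l0) (simp add: field_simps)
      also have "\<dots> = Y / c" by (simp add: Y_def sum_divide_distrib)
      finally have "c \<le> 1 / (\<Sum>i\<in>UNIV. lam i * (1 / a i)) * Y"
        using c0 R by (simp add: field_simps)
      moreover have "power_mean lam (ereal (-1)) a = 1 / (\<Sum>i\<in>UNIV. lam i * (1 / a i))"
        using False R a' by (simp add: power_mean_neg_exponent less_imp_le[OF a'])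
      ultimately show ?thesis
        by (simp add: MInfty power_mean_MInfty power_transform_def c_def Y_def one_ereal_def uminus_ereal.simps(1)[symmetric] del: uminus_ereal.simps)
    qed
  next
    case (neg r)
    show ?thesis
    proof (cases "\<exists>i. a i = 0")
      case True then show ?thesis using * neg by force
    next
      case False
      with a have a': "0 < a i" for i by (metis less_eq_real_def)
      define s where "s = r / (1 - r)"
      \<comment> \<open>Chosen so that \<open>y\<close> cancels from
        \<open>((a * y)^r)^\<alpha> * y^(1-\<alpha>)\<close>, leaving \<open>a^s\<close>. Hoelder's
        inequality then bounds \<open>A\<close>, and the negative power \<open>1/s\<close> turns it
        around.\<close>
      define \<alpha> where "\<alpha> = 1 / (1 - r)"
      have \<alpha>: "0 < \<alpha>" "\<alpha> < 1" "r * \<alpha> = s" "1 - \<alpha> = - s" "s < 0" "\<alpha> * (1 / s) = 1 / r" "(- s) * (1 / s) = -1"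
        using neg by (auto simp: \<alpha>_def s_def field_simps)
      have T: "power_transform 1 (ereal r) = ereal s"
        using neg by (simp add: power_transform_def s_def)
      define A X where "A = (\<Sum>i\<in>UNIV. lam i * a i powr s)" and "X = (\<Sum>i\<in>UNIV. lam i * (a i * y i) powr r)"
      have A: "0 < A" unfolding A_def using a' by (intro weighted_sum_pos[OF w]) (simp add: less_imp_neq[THEN not_sym])
      have X: "0 < X" unfolding X_def using a' y by (intro weighted_sum_pos[OF w]) (simp add: less_imp_neq[THEN not_sym])
      have "((a i * y i) powr r) powr \<alpha> * y i powr (1 - \<alpha>) = a i powr s" for i
      proof -
        have "((a i * y i) powr r) powr \<alpha> * y i powr (1 - \<alpha>) = a i powr (r * \<alpha>) * y i powr (r * \<alpha> + (1 - \<alpha>))"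
          by (simp add: powr_mult powr_powr powr_add)
        then show ?thesis using y[of i] by (simp only: \<alpha>) simp
      qed
      then have "A = (\<Sum>i\<in>UNIV. lam i * (((a i * y i) powr r) powr \<alpha> * y i powr (1 - \<alpha>)))"
        by (simp add: A_def)
      also have "\<dots> \<le> X powr \<alpha> * Y powr (1 - \<alpha>)"
        unfolding X_def Y_def using y by (intro weighted_Hoelder_sum \<alpha> l) (auto intro: less_imp_le)
      finally have "(X powr \<alpha> * Y powr (- s)) powr (1/s) \<le> A powr (1/s)"
        using A \<alpha> by (intro powr_mono2') auto
      also have "(X powr \<alpha> * Y powr (- s)) powr (1/s) = X powr (\<alpha> * (1/s)) * Y powr ((-s) * (1/s))"
        by (simp only: powr_mult powr_powr)
      also have "\<dots> = X powr (1/r) / Y" using Y by (simp only: \<alpha>) simp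
      finally show ?thesis
        using False Y y by (simp add: T del: One_nat_def add: power_mean_neg_exponent \<alpha> neg A_def X_def Y_def pos_divide_le_eq less_imp_neq[THEN not_sym])
    qed
  next
    case zero
    have "power_mean lam 0 (\<lambda>i. a i * y i) = power_mean lam 0 a * power_mean lam 0 y"
      by (simp add: power_mean_zero powr_mult prod.distrib)
    also have "\<dots> \<le> power_mean lam 0 a * Y"
      using weighted_arith_geom_mean[OF w, of y] y power_mean_nonneg[OF a, of lam 0]
      by (intro mult_left_mono) (auto simp: power_mean_zero Y_def less_imp_le)
    finally show ?thesis
      by (simp add: zero power_transform_def Y_def flip: zero_ereal_def)
  next
    case (pos r)
    show ?thesis
    proof (cases "r = 1")
      case True
      have m: "a i \<le> Max (range a)" for i by auto
      have "(\<Sum>i\<in>UNIV. lam i * (a i * y i)) \<le> (\<Sum>i\<in>UNIV. lam i * (Max (range a) * y i))"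
        using m y by (intro sum_mono mult_left_mono mult_right_mono l0) (auto intro: less_imp_le)
      moreover have "0 \<le> (\<Sum>i\<in>UNIV. lam i * (a i * y i))"
        using ay l0 by (intro sum_nonneg) auto
      ultimately show ?thesis
        using True pos ay by (simp add: power_mean_pos_exponent power_transform_def power_mean_PInfty
            sum_distrib_left mult_ac abs_of_nonneg)
    next
      case False
      then have r: "0 < r" "r < 1" using q pos by auto
      define s where "s = r / (1 - r)"
      have s: "0 < s" "s * (1 - r) = r" "(1 - r) * (1 / r) = 1 / s"
        using r by (auto simp: s_def field_simps)
      have T: "power_transform 1 (ereal r) = ereal s"
        using pos False by (simp add: power_transform_def s_def)
      have "(a i * y i) powr r = (a i powr s) powr (1 - r) * y i powr (1 - (1 - r))" for i
        by (simp add: powr_powr powr_mult s)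
      then have "(\<Sum>i\<in>UNIV. lam i * (a i * y i) powr r)
        = (\<Sum>i\<in>UNIV. lam i * ((a i powr s) powr (1 - r) * y i powr (1 - (1 - r))))"
        by simp
      also have "\<dots> \<le> (\<Sum>i\<in>UNIV. lam i * a i powr s) powr (1 - r) * Y powr (1 - (1 - r))"
        unfolding Y_def using r y by (intro weighted_Hoelder_sum l) (auto intro: less_imp_le)
      finally have "(\<Sum>i\<in>UNIV. lam i * (a i * y i) powr r) powr (1/r)
        \<le> ((\<Sum>i\<in>UNIV. lam i * a i powr s) powr (1 - r) * Y powr r) powr (1/r)"
        using r by (intro powr_mono2 sum_nonneg) (auto simp: l0)
      also have "\<dots> = (\<Sum>i\<in>UNIV. lam i * a i powr s) powr ((1 - r) * (1/r)) * Y"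
        using r Y by (simp add: powr_mult powr_powr)
      finally show ?thesis
        using pos s by (simp add: T power_mean_pos_exponent Y_def del: One_nat_def)
    qed
  qed (use q in auto)
qed

text \<open>For reciprocals the transform is a shift: \<open>1 / Q_n(p) = 1/p - n\<close>, so
  \<open>n\<close> applications of \<open>Q_1\<close> give \<open>Q_n\<close>. The bound by 1 comes
  from \<open>Q_n(1/(n+1)) = 1\<close> and is what the one-dimensional inequality demands before
  each further application.\<close>

lemma power_transform_iterate:
  assumes "p \<le> ereal (1 / real (Suc n))"
  shows "(power_transform 1 ^^ Suc n) p = power_transform (Suc n) p"
    and "(power_transform 1 ^^ n) p \<le> 1"
proof -
  \<comment> \<open>Only for positive \<open>n\<close>: \<open>1 / 0 = 0\<close> makes
    \<open>power_transform 0\<close> infinite at 0, so it is not the identity and the induction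
    below starts with one application.\<close>
  have step: "power_transform n p \<le> 1 \<and> power_transform 1 (power_transform n p) = power_transform (Suc n) p"
    if n: "0 < n" and p: "p \<le> ereal (1 / real (Suc n))" for n p
  proof (cases p)
    case (real r)
    have r: "r \<le> 1 / (1 + real n)" using p real by simp
    then have "r < 1 / real n"
      using n by (smt (verit) frac_less2 of_nat_0_less_iff)
    then have d: "r * real n < 1" using n by (simp add: field_simps)
    have d': "r * real n + r \<le> 1" using r by (simp add: field_simps)
    have 1: "power_transform n p = ereal (r / (1 - real n * r))"
      using d n real by (auto simp: power_transform_def field_simps)
    have 2: "r / (1 - real n * r) \<le> 1" using d d' by (simp add: field_simps)
    show ?thesis
    proof (cases "r * real n + r = 1")
      case True
      then have "r = 1 / (1 + real n)" "r / (1 - real n * r) = 1" using d by (auto simp: field_simps)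
      then show ?thesis using 1 2 real by (simp add: power_transform_def one_ereal_def)
    next
      case False
      then have "r / (1 - real n * r) \<noteq> 1" "r \<noteq> 1 / (1 + real n)" using d by (auto simp: field_simps)
      moreover have "r / (1 - real n * r) / (1 - r / (1 - real n * r)) = r / (1 - (1 + real n) * r)"
        using d d' False by (simp add: divide_simps) (simp add: algebra_simps)
      ultimately show ?thesis using 1 2 real by (simp add: power_transform_def one_ereal_def)
    qed
  next
    case MInf
    have "(-1 / real n) / (1 - (-1 / real n)) = -1 / (1 + real n)"
      using n by (simp add: field_simps)
    moreover have "-1 / real n \<noteq> 1" "-1 / real n \<le> 1" using n by (auto simp: field_simps)
    ultimately show ?thesis using MInf n by (simp add: power_transform_def one_ereal_def)
  qed (use p in auto)
  have mono: "ereal (1 / real (Suc (Suc n))) \<le> ereal (1 / real (Suc n))" for n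
    by (simp add: field_simps)
  have main: "(power_transform 1 ^^ Suc n) p = power_transform (Suc n) p \<and> (power_transform 1 ^^ n) p \<le> 1"
    if "p \<le> ereal (1 / real (Suc n))" for n
    using that
  proof (induction n)
    case 0
    then show ?case by (simp add: one_ereal_def)
  next
    case (Suc n)
    then have IH: "(power_transform 1 ^^ Suc n) p = power_transform (Suc n) p"
      using mono[of n] order.trans by blast
    show ?case
      using step[of "Suc n" p] Suc.prems IH
      by (subst funpow.simps(2), subst o_apply) (simp only: zero_less_Suc)
  qed
  show "(power_transform 1 ^^ Suc n) p = power_transform (Suc n) p" "(power_transform 1 ^^ n) p \<le> 1"
    using main[OF assms] by auto
qed

subsection \<open>Dimension one\<close>

text \<open>The Brunn-Minkowski inequality on the line. With \<open>a = max X\<close> and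
  \<open>b = min Y\<close>, the sum set contains the translates \<open>X + b\<close> and
  \<open>a + Y\<close>, which meet only in the point \<open>a + b\<close>.\<close>

lemma emeasure_compact_sum_ge:
  fixes X Y :: "real set"
  assumes X: "compact X" "X \<noteq> {}" and Y: "compact Y" "Y \<noteq> {}"
  shows "emeasure lebesgue X + emeasure lebesgue Y \<le> emeasure lebesgue {x + y |x y. x \<in> X \<and> y \<in> Y}"
proof -
  obtain a where a: "a \<in> X" "\<And>x. x \<in> X \<Longrightarrow> x \<le> a" using compact_attains_sup[OF X] by blast
  obtain b where b: "b \<in> Y" "\<And>y. y \<in> Y \<Longrightarrow> b \<le> y" using compact_attains_inf[OF Y] by blast
  define X' Y' where "X' = (\<lambda>x. 1 *\<^sub>R x + b) ` X" and "Y' = (\<lambda>y. 1 *\<^sub>R y + a) ` Y"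
  have X': "X' \<in> sets lebesgue" "emeasure lebesgue X' = emeasure lebesgue X"
    and Y': "Y' \<in> sets lebesgue" "emeasure lebesgue Y' = emeasure lebesgue Y"
    unfolding X'_def Y'_def
    using X Y by (auto simp only: emeasure_lebesgue_affine intro!: fmeasurableD lmeasurable_compact
        compact_continuous_image continuous_intros) auto
  have n: "{a + b} \<in> null_sets lebesgue" by (simp add: null_sets_completionI)
  have "emeasure lebesgue X + emeasure lebesgue Y = emeasure lebesgue X' + emeasure lebesgue (Y' - {a + b})"
    using X' Y' emeasure_Diff_null_set[OF n Y'(1)] by simp
  also have "\<dots> = emeasure lebesgue (X' \<union> (Y' - {a + b}))"
  proof (rule plus_emeasure)
    show "X' \<inter> (Y' - {a + b}) = {}"
      unfolding X'_def Y'_def using a(2) b(2) by (fastforce simp: add.commute)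
  qed (use X' Y' in auto)
  also have "\<dots> \<le> emeasure lebesgue {x + y |x y. x \<in> X \<and> y \<in> Y}"
  proof (rule emeasure_mono)
    show "X' \<union> (Y' - {a + b}) \<subseteq> {x + y |x y. x \<in> X \<and> y \<in> Y}"
      unfolding X'_def Y'_def using a(1) b(1) by auto (metis add.commute)+
    show "{x + y |x y. x \<in> X \<and> y \<in> Y} \<in> sets lebesgue"
      using X Y by (intro fmeasurableD lmeasurable_compact compact_sums)
  qed
  finally show ?thesis .
qed

text \<open>Compactness and nonemptiness of the sum belong to the conclusion because the induction
  step applies the case of two sets to the partial sum.\<close>

lemma emeasure_compact_family_sum_ge:
  fixes K :: "'i \<Rightarrow> real set"
  assumes "finite I" "\<And>i. i \<in> I \<Longrightarrow> compact (K i) \<and> K i \<noteq> {}"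
  shows "compact ((\<lambda>x. \<Sum>i\<in>I. x i) ` Pi I K) \<and> (\<lambda>x. \<Sum>i\<in>I. x i) ` Pi I K \<noteq> {} \<and>
    (\<Sum>i\<in>I. emeasure lebesgue (K i)) \<le> emeasure lebesgue ((\<lambda>x. \<Sum>i\<in>I. x i) ` Pi I K)"
  using assms
proof (induction I rule: finite_induct)
  case empty
  then show ?case by (simp add: image_constant_conv)
next
  case (insert j I)
  let ?S = "\<lambda>I. (\<lambda>x. \<Sum>i\<in>I. x i) ` Pi I K"
  have IH: "compact (?S I)" "?S I \<noteq> {}" "(\<Sum>i\<in>I. emeasure lebesgue (K i)) \<le> emeasure lebesgue (?S I)"
    using insert by auto
  have j: "compact (K j)" "K j \<noteq> {}" using insert.prems by auto
  have "?S (insert j I) = {x + y |x y. x \<in> K j \<and> y \<in> ?S I}"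
  proof safe
    fix x assume "x \<in> Pi (insert j I) K"
    then show "\<exists>a b. (\<Sum>i\<in>insert j I. x i) = a + b \<and> a \<in> K j \<and> b \<in> ?S I"
      using insert.hyps by (intro exI[of _ "x j"] exI[of _ "\<Sum>i\<in>I. x i"]) auto
  next
    fix a y assume a: "a \<in> K j" and y: "y \<in> Pi I K"
    have "a + (\<Sum>i\<in>I. y i) = (\<Sum>i\<in>insert j I. (y(j := a)) i)"
      using insert.hyps by (simp add: sum.insert_if) (auto intro!: sum.cong)
    moreover have "y(j := a) \<in> Pi (insert j I) K" using a y by auto
    ultimately show "a + (\<Sum>i\<in>I. y i) \<in> ?S (insert j I)" by blast
  qed
  moreover have "emeasure lebesgue (K j) + (\<Sum>i\<in>I. emeasure lebesgue (K i))
    \<le> emeasure lebesgue {x + y |x y. x \<in> K j \<and> y \<in> ?S I}"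
    using emeasure_compact_sum_ge[OF j IH(1,2)] IH(3) by (meson add_left_mono order.trans)
  ultimately show ?case
    using insert.hyps compact_sums[OF j(1) IH(1)] j IH(2) by (auto; blast)
qed

lemma inner_compact_lborel:
  fixes A :: "real set"
  assumes A: "A \<in> sets borel" "A \<noteq> {}" and fin: "emeasure lborel A < \<infinity>" and e: "0 < e"
  obtains K where "compact K" "K \<noteq> {}" "K \<subseteq> A" "emeasure lborel A \<le> emeasure lborel K + ennreal e"
proof -
  \<comment> \<open>Inner regularity is a statement about finite measures, hence the restriction of
    Lebesgue measure to \<open>A\<close>.\<close>
  let ?M = "density lborel (indicator A)"
  have M: "emeasure ?M X = emeasure lborel (A \<inter> X)" if "X \<in> sets borel" for X
    using A that by (simp add: emeasure_density nn_integral_indicator flip: indicator_inter_arith)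
  have "emeasure ?M A = (SUP K\<in>{K. K \<subseteq> A \<and> compact K}. emeasure ?M K)"
    using A fin by (intro inner_regular) (auto simp: M)
  then have S: "emeasure lborel A = (SUP K\<in>{K. K \<subseteq> A \<and> compact K}. emeasure lborel K)"
    using A by (simp add: M borel_compact Int_absorb1 cong: SUP_cong_simp)
  obtain a where a: "a \<in> A" using A by auto
  show thesis
  proof (cases "emeasure lborel A = 0")
    case True
    then show thesis using a by (intro that[of "{a}"]) auto
  next
    case False
    then have "emeasure lborel A - ennreal e < emeasure lborel A"
      using fin e by (intro ennreal_between) (auto simp: zero_less_iff_neq_zero)
    then obtain K where K: "K \<subseteq> A" "compact K" "emeasure lborel A - ennreal e < emeasure lborel K"
      unfolding S[symmetric] using S by (metis (mono_tags, lifting) less_SUP_iff mem_Collect_eq)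
    then have "emeasure lborel A \<le> emeasure lborel K + ennreal e"
      by (metis add.commute ennreal_minus_le_iff less_imp_le)
    moreover have "K \<noteq> {}" using K(3) by auto
    ultimately show thesis using that K by auto
  qed
qed

text \<open>A sum of Borel sets need not be Borel, so the bound is for a Borel superset
  \<open>B\<close>. Approximating each \<open>A i\<close> from inside by a compact set leaves sums
  of compact sets, and as the weights add up to 1 the total error is at most
  \<open>e\<close>.\<close>

lemma emeasure_weighted_sum_ge:
  fixes A :: "'m::finite \<Rightarrow> real set"
  assumes w: "weight lam" and A: "\<And>i. A i \<in> sets borel" "\<And>i. A i \<noteq> {}"
    and fin: "\<And>i. emeasure lborel (A i) < \<infinity>"
    and B: "B \<in> sets borel" "\<And>x. (\<And>i. x i \<in> A i) \<Longrightarrow> (\<Sum>i\<in>UNIV. lam i * x i) \<in> B"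
  shows "(\<Sum>i\<in>UNIV. ennreal (lam i) * emeasure lborel (A i)) \<le> emeasure lborel B"
proof (rule ennreal_le_epsilon)
  fix e :: real assume e: "0 < e"
  have "\<exists>K. compact K \<and> K \<noteq> {} \<and> K \<subseteq> A i \<and> emeasure lborel (A i) \<le> emeasure lborel K + ennreal e" for i
    using inner_compact_lborel[OF A fin e] by metis
  then obtain K where K: "\<And>i. compact (K i)" "\<And>i. K i \<noteq> {}" "\<And>i. K i \<subseteq> A i"
    and Ke: "\<And>i. emeasure lborel (A i) \<le> emeasure lborel (K i) + ennreal e"
    by metis
  define L where "L i = (\<lambda>x. lam i *\<^sub>R x + 0) ` K i" for i
  have L: "emeasure lebesgue (L i) = ennreal (lam i) * emeasure lborel (K i)" for i
    unfolding L_def using K(1)[of i] weight_nonneg[OF w, of i]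
    by (simp only: emeasure_lebesgue_affine) (simp add: borel_compact)
  have "compact (L i) \<and> L i \<noteq> {}" for i
    unfolding L_def using K by (auto intro!: compact_continuous_image continuous_intros)
  from emeasure_compact_family_sum_ge[of UNIV L, OF _ this]
  have "(\<Sum>i\<in>UNIV. emeasure lebesgue (L i)) \<le> emeasure lebesgue ((\<lambda>x. \<Sum>i\<in>UNIV. x i) ` Pi UNIV L)"
    by simp
  also have "\<dots> \<le> emeasure lebesgue B"
  proof (rule emeasure_mono)
    show "(\<lambda>x. \<Sum>i\<in>UNIV. x i) ` Pi UNIV L \<subseteq> B"
    proof safe
      fix y assume "y \<in> Pi UNIV L"
      then have "\<forall>i. \<exists>x. x \<in> K i \<and> y i = lam i * x" by (auto simp: L_def Pi_iff)
      then obtain x where "\<And>i. x i \<in> K i" "\<And>i. y i = lam i * x i" by metis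
      then show "(\<Sum>i\<in>UNIV. y i) \<in> B" using K(3) by (auto intro!: B(2))
    qed
  qed (use B in auto)
  finally have *: "(\<Sum>i\<in>UNIV. ennreal (lam i) * emeasure lborel (K i)) \<le> emeasure lborel B"
    using B by (simp add: L)
  have "(\<Sum>i\<in>UNIV. ennreal (lam i) * emeasure lborel (A i))
    \<le> (\<Sum>i\<in>UNIV. ennreal (lam i) * (emeasure lborel (K i) + ennreal e))"
    by (intro sum_mono mult_left_mono Ke) auto
  also have "\<dots> = (\<Sum>i\<in>UNIV. ennreal (lam i) * emeasure lborel (K i)) + (\<Sum>i\<in>UNIV. ennreal (lam i)) * ennreal e"
    by (simp add: distrib_left sum.distrib sum_distrib_right)
  also have "(\<Sum>i\<in>UNIV. ennreal (lam i)) = 1"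
    using weight_nonneg[OF w] weight_sum[OF w] by (simp add: sum_ennreal)
  finally show "(\<Sum>i\<in>UNIV. ennreal (lam i) * emeasure lborel (A i)) \<le> emeasure lborel B + ennreal e"
    using * by (simp add: add_mono order.trans)
qed

lemma nn_integral_level_sets:
  fixes f :: "real \<Rightarrow> real"
  assumes [measurable]: "f \<in> borel_measurable borel" and f: "\<And>x. 0 \<le> f x"
  shows "(\<integral>\<^sup>+ t. indicator {0<..<1} t * emeasure lborel {x. t \<le> f x} \<partial>lborel)
    = (\<integral>\<^sup>+ x. ennreal (min (f x) 1) \<partial>lborel)"
proof -
  have "(\<integral>\<^sup>+ t. indicator {0<..<1} t * emeasure lborel {x. t \<le> f x} \<partial>lborel)
    = (\<integral>\<^sup>+ t. (\<integral>\<^sup>+ x. indicator {0<..<1::real} t * indicator {x. t \<le> f x} x \<partial>lborel) \<partial>lborel)"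
    by (intro nn_integral_cong) (simp add: nn_integral_cmult)
  also have "\<dots> = (\<integral>\<^sup>+ t. (\<integral>\<^sup>+ x. indicator {0<..<1::real} t * indicator {p. fst p \<le> f (snd p)} (t, x) \<partial>lborel) \<partial>lborel)"
    by (simp add: indicator_def)
  also have "\<dots> = (\<integral>\<^sup>+ x. (\<integral>\<^sup>+ t. indicator {0<..<1::real} t * indicator {p. fst p \<le> f (snd p)} (t, x) \<partial>lborel) \<partial>lborel)"
    by (rule lborel_pair.Fubini') measurable
  also have "\<dots> = (\<integral>\<^sup>+ x. ennreal (min (f x) 1) \<partial>lborel)"
  proof (rule nn_integral_cong)
    fix x
    have "(\<integral>\<^sup>+ t. indicator {0<..<1::real} t * indicator {p. fst p \<le> f (snd p)} (t, x) \<partial>lborel)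
      = (\<integral>\<^sup>+ t. indicator (if f x < 1 then {0<..f x} else {0<..<1}) t \<partial>lborel)"
      by (intro nn_integral_cong) (auto simp: indicator_def)
    also have "\<dots> = ennreal (min (f x) 1)"
      using f[of x] by (subst nn_integral_indicator) auto
    finally show "(\<integral>\<^sup>+ t. indicator {0<..<1::real} t * indicator {p. fst p \<le> f (snd p)} (t, x) \<partial>lborel)
      = ennreal (min (f x) 1)" .
  qed
  finally show ?thesis .
qed

text \<open>\<open>h\<close> acts as the supremum of \<open>f\<close>. If \<open>f\<close> is
  bounded it is the supremum; otherwise every level is reached, and by dominated convergence
  truncation at a large \<open>h\<close> loses at most the fraction \<open>e\<close> of the
  integral.\<close>

lemma truncation_level:
  fixes f :: "'a \<Rightarrow> real"
  assumes f: "integrable M f" "\<And>x. 0 \<le> f x" "0 < integral\<^sup>L M f" and e: "0 < e"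
  obtains h where "0 < h" "\<And>t. t < h \<Longrightarrow> \<exists>x. t \<le> f x"
    "(1 - e) * integral\<^sup>L M f \<le> (\<integral>x. min (f x) h \<partial>M)"
proof (cases "bdd_above (range f)")
  case True
  define h where "h = Sup (range f)"
  have h: "f x \<le> h" for x unfolding h_def using True by (intro cSup_upper) auto
  have "\<exists>x. 0 < f x"
  proof (rule ccontr)
    assume "\<not> (\<exists>x. 0 < f x)"
    then have "f = (\<lambda>_. 0)" using f(2) by (auto simp: fun_eq_iff not_less intro: antisym)
    then show False using f(3) by simp
  qed
  then have "0 < h" using h by (meson less_le_trans)
  moreover have "\<exists>x. t \<le> f x" if "t < h" for t
    using that less_cSup_iff[of "range f" t] True unfolding h_def by (auto intro: less_imp_le)
  moreover have "(1 - e) * integral\<^sup>L M f \<le> (\<integral>x. min (f x) h \<partial>M)"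
    using h e f(3) by (simp add: min_absorb1)
  ultimately show thesis by (rule that)
next
  case False
  have "(\<lambda>n. \<integral>x. min (f x) (real n) \<partial>M) \<longlonglongrightarrow> integral\<^sup>L M f"
  proof (rule integral_dominated_convergence[where w=f])
    show "AE x in M. (\<lambda>n. min (f x) (real n)) \<longlonglongrightarrow> f x"
    proof (rule AE_I2, rule tendsto_eventually)
      fix x
      obtain n0 where "f x \<le> real n0" using real_arch_simple by blast
      then show "\<forall>\<^sub>F n in sequentially. min (f x) (real n) = f x"
        by (intro eventually_sequentiallyI[of n0]) (auto simp: min_def)
    qed
  qed (use f in auto)
  moreover have "(1 - e) * integral\<^sup>L M f < integral\<^sup>L M f" using f(3) e by simp
  ultimately have "\<forall>\<^sub>F n in sequentially. (1 - e) * integral\<^sup>L M f < (\<integral>x. min (f x) (real n) \<partial>M)"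
    by (rule order_tendstoD)
  then obtain n0 where n0: "\<And>n. n0 \<le> n \<Longrightarrow> (1 - e) * integral\<^sup>L M f < (\<integral>x. min (f x) (real n) \<partial>M)"
    by (auto simp: eventually_sequentially)
  show thesis
  proof (rule that[of "real (Suc n0)"])
    show "\<exists>x. t \<le> f x" for t using False by (meson bdd_above.I2 nle_le)
  qed (use n0[of "Suc n0"] in auto)
qed

text \<open>With heights \<open>h i\<close> and \<open>Y\<close> the weighted mean of the normalised
  integrals of the \<open>F i\<close>, the level sets give
  \<open>(1 - e) * Y \<le> power_mean lam q b / c\<close>, where \<open>b\<close> collects the
  integrals of the \<open>G i / h i\<close>. Hoelder's inequality bounds this mean by a multiple of
  \<open>Y\<close>, and \<open>Y\<close> cancels.\<close>

lemma power_mean_ratio_one_dim: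
  fixes F G :: "'m::finite \<Rightarrow> real \<Rightarrow> real"
  assumes w: "weight lam" and q: "q \<le> 1" and c: "0 < c"
    and F: "\<And>i x. 0 \<le> F i x" "\<And>i. integrable lborel (F i)" "\<And>i. 0 < integral\<^sup>L lborel (F i)"
    and G: "\<And>i x. 0 \<le> G i x" "\<And>i. integrable lborel (G i)"
    and N: "N \<in> null_sets lborel"
    and H: "\<And>s z. (\<And>i. 0 < F i (s i)) \<Longrightarrow> z = (\<Sum>i\<in>UNIV. lam i * s i) \<Longrightarrow> z \<notin> N \<Longrightarrow>
      c \<le> power_mean lam q (\<lambda>i. G i z / F i (s i))"
  shows "c \<le> power_mean lam (power_transform 1 q) (\<lambda>i. integral\<^sup>L lborel (G i) / integral\<^sup>L lborel (F i))"
    (is "c \<le> ?R")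
proof -
  note l = weight_pos[OF w] and l0 = weight_nonneg[OF w]
  define \<phi> \<gamma> where "\<phi> i = integral\<^sup>L lborel (F i)" and "\<gamma> i = integral\<^sup>L lborel (G i)" for i
  have \<gamma>: "0 \<le> \<gamma> i" and \<phi>: "0 < \<phi> i" for i
    unfolding \<gamma>_def \<phi>_def using G F by auto
  have [measurable]: "F i \<in> borel_measurable borel" "G i \<in> borel_measurable borel" for i
    using F(2)[of i] G(2)[of i] by auto
  have main: "c * (1 - e) \<le> ?R" if e: "0 < e" for e
  proof -
    have "\<exists>h. 0 < h \<and> (\<forall>t. t < h \<longrightarrow> (\<exists>x. t \<le> F i x)) \<and> (1 - e) * \<phi> i \<le> (\<integral>x. min (F i x) h \<partial>lborel)" for i
      using truncation_level[OF F(2) F(1) F(3) e, of i] unfolding \<phi>_def by metis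
    then obtain h where h: "\<And>i. 0 < h i" "\<And>i t. t < h i \<Longrightarrow> \<exists>x. t \<le> F i x"
      "\<And>i. (1 - e) * \<phi> i \<le> (\<integral>x. min (F i x) (h i) \<partial>lborel)"
      by metis
    define b where "b i = \<gamma> i / h i" for i
    have b: "0 \<le> b i" for i unfolding b_def using \<gamma>[of i] h(1)[of i] by simp
    \<comment> \<open>Jensen's inequality in linear form: the supergradient at the integrals
      \<open>b\<close> dominates the mean of the \<open>G i / h i\<close> at almost every point,
      integrates termwise, and is at most the mean at \<open>b\<close> itself.\<close>
    obtain v where v: "\<And>i. 0 \<le> v i" "(\<Sum>i\<in>UNIV. v i * b i) \<le> power_mean lam q b"
      "\<And>u. \<forall>i. 0 \<le> u i \<Longrightarrow> \<forall>i. b i = 0 \<longrightarrow> u i = 0 \<Longrightarrow> power_mean lam q u \<le> (\<Sum>i\<in>UNIV. v i * u i)"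
      using power_mean_supergradient[where b=b, OF w q b] by metis
    define g where "g z = (\<Sum>i\<in>UNIV. v i * (G i z / h i)) / c" for z
    have [measurable]: "g \<in> borel_measurable borel" unfolding g_def by measurable
    have g0: "0 \<le> g z" for z
      unfolding g_def using c v(1) G(1) h(1) by (auto intro!: divide_nonneg_pos sum_nonneg mult_nonneg_nonneg)
    have int_g: "integrable lborel g" "integral\<^sup>L lborel g = (\<Sum>i\<in>UNIV. v i * b i) / c"
      unfolding g_def b_def \<gamma>_def using G(2) by auto
    \<comment> \<open>The supergradient bound requires \<open>G i z = 0\<close> whenever
      \<open>b i = 0\<close>. Such a \<open>G i\<close> has integral 0, so this fails only on a null
      set, which joins the exceptional set.\<close>
    define N' where "N' = N \<union> (\<Union>i\<in>{i. b i = 0}. {z \<in> space lborel. G i z \<noteq> 0})"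
    have "{z \<in> space lborel. G i z \<noteq> 0} \<in> null_sets lborel" if "b i = 0" for i
    proof -
      have "integral\<^sup>L lborel (G i) = 0" using that h(1)[of i] by (simp add: b_def \<gamma>_def)
      then have "AE z in lborel. G i z = 0"
        using integral_nonneg_eq_0_iff_AE[OF G(2)[of i]] G(1) by simp
      then show ?thesis by (subst AE_iff_null_sets) auto
    qed
    then have N': "N' \<in> null_sets lborel"
      unfolding N'_def using N by (intro null_sets.Un null_sets.finite_UN) auto
    have level: "(\<Sum>i\<in>UNIV. ennreal (lam i) * emeasure lborel {x. t \<le> F i x / h i}) \<le> emeasure lborel {z. t \<le> g z}"
      if t: "0 < t" "t < 1" for t
    proof -
      have fin: "emeasure lborel {x. t \<le> F i x / h i} < \<infinity>" for i
      proof -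
        have "{x. t \<le> F i x / h i} = {x \<in> space lborel. t * h i \<le> F i x}"
          using h(1)[of i] by (auto simp: field_simps)
        then have "emeasure lborel {x. t \<le> F i x / h i} \<le> ennreal (1 / (t * h i) * integral\<^sup>L lborel (F i))"
          using integral_Markov_inequality[OF F(2)[of i], of "t * h i"] F(1) t h(1)[of i] by simp
        then show ?thesis by (simp add: order.strict_trans1)
      qed
      \<comment> \<open>Adding the null set \<open>N'\<close> to the superlevel set of
        \<open>g\<close> makes the inclusion hold at every point, without changing the
        measure.\<close>
      have "(\<Sum>i\<in>UNIV. ennreal (lam i) * emeasure lborel {x. t \<le> F i x / h i}) \<le> emeasure lborel ({z. t \<le> g z} \<union> N')"
      proof (rule emeasure_weighted_sum_ge[OF w _ _ fin])
        show "{x. t \<le> F i x / h i} \<noteq> {}" for i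
          using h(2)[of "t * h i" i] h(1)[of i] t by (auto simp: field_simps)
        fix s assume s': "\<And>i. s i \<in> {x. t \<le> F i x / h i}"
        then have s: "t * h i \<le> F i (s i)" for i using s'[of i] h(1)[of i] by (simp add: field_simps)
        then have Fp: "0 < F i (s i)" for i
          using t h(1)[of i] by (meson less_le_trans mult_pos_pos)
        define z where "z = (\<Sum>i\<in>UNIV. lam i * s i)"
        have "t \<le> g z" if z: "z \<notin> N'"
        proof -
          have "c \<le> power_mean lam q (\<lambda>i. G i z / F i (s i))"
            by (rule H[OF Fp z_def]) (use z in \<open>auto simp: N'_def\<close>)
          also have "\<dots> \<le> power_mean lam q (\<lambda>i. (1/t) * (G i z / h i))"
          proof (rule power_mean_mono[OF w])
            show "G i z / F i (s i) \<le> (1/t) * (G i z / h i)" for i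
              using divide_left_mono[OF s[of i] G(1)[of i z]] t h(1)[of i] Fp[of i] by simp
          qed (use G F in auto)
          also have "\<dots> = (1/t) * power_mean lam q (\<lambda>i. G i z / h i)"
            using t by (intro power_mean_scale[OF w]) auto
          also have "\<dots> \<le> (1/t) * (\<Sum>i\<in>UNIV. v i * (G i z / h i))"
            using t z h(1) G(1) by (intro mult_left_mono v(3)) (auto simp: N'_def less_imp_le)
          also have "\<dots> = c * g z / t" using c by (simp add: g_def)
          finally show ?thesis using t c by (simp add: field_simps)
        qed
        then show "(\<Sum>i\<in>UNIV. lam i * s i) \<in> {z. t \<le> g z} \<union> N'" by (auto simp: z_def)
      qed (use N' in auto)
      also have "\<dots> = emeasure lborel {z. t \<le> g z}"
        using N' by (intro emeasure_Un_null_set) auto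
      finally show ?thesis .
    qed
    have meas: "(\<lambda>t. emeasure lborel {x. t \<le> f x}) \<in> borel_measurable borel"
      if [measurable]: "f \<in> borel_measurable borel" for f :: "real \<Rightarrow> real"
    proof -
      have "(\<lambda>t. \<integral>\<^sup>+x. indicator {p. fst p \<le> f (snd p)} (t, x) \<partial>lborel) \<in> borel_measurable borel"
        by measurable
      also have "(\<lambda>t. \<integral>\<^sup>+x. indicator {p. fst p \<le> f (snd p)} (t, x) \<partial>lborel) = (\<lambda>t. emeasure lborel {x. t \<le> f x})"
      proof
        fix t
        have "(\<integral>\<^sup>+x. indicator {p. fst p \<le> f (snd p)} (t, x) \<partial>lborel) = (\<integral>\<^sup>+x. indicator {x. t \<le> f x} x \<partial>lborel)"
          by (intro nn_integral_cong) (auto simp: indicator_def)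
        then show "(\<integral>\<^sup>+x. indicator {p. fst p \<le> f (snd p)} (t, x) \<partial>lborel) = emeasure lborel {x. t \<le> f x}"
          by simp
      qed
      finally show ?thesis .
    qed
    have lower: "ennreal ((1 - e) * (\<phi> i / h i)) \<le> (\<integral>\<^sup>+x. ennreal (min (F i x / h i) 1) \<partial>lborel)" for i
    proof -
      have int: "integrable lborel (\<lambda>x. min (F i x / h i) 1)"
        by (rule Bochner_Integration.integrable_bound[of _ "\<lambda>x. F i x / h i"])
          (use F h(1)[of i] in \<open>auto simp: abs_of_nonneg min_def\<close>)
      have "(1 - e) * \<phi> i / h i \<le> (\<integral>x. min (F i x) (h i) \<partial>lborel) / h i"
        using h(3)[of i] h(1)[of i] by (simp add: divide_right_mono)
      also have "\<dots> = (\<integral>x. min (F i x) (h i) / h i \<partial>lborel)" by simp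
      also have "\<dots> = (\<integral>x. min (F i x / h i) 1 \<partial>lborel)"
        using h(1)[of i] by (intro Bochner_Integration.integral_cong) (auto simp: min_def field_simps)
      finally show ?thesis
        using F(1)[of i] h(1)[of i] by (subst nn_integral_eq_integral[OF int]) (auto intro!: ennreal_leI)
    qed
    define Y where "Y = (\<Sum>i\<in>UNIV. lam i * (\<phi> i / h i))"
    have Y: "0 < Y" unfolding Y_def by (intro weighted_sum_pos[OF w]) (use \<phi> h in auto)
    have "ennreal ((1 - e) * Y) \<le> (\<Sum>i\<in>UNIV. ennreal (lam i) * ennreal ((1 - e) * (\<phi> i / h i)))"
    proof (cases "e \<le> 1")
      case True
      have "(\<Sum>i\<in>UNIV. ennreal (lam i) * ennreal ((1 - e) * (\<phi> i / h i)))
        = (\<Sum>i\<in>UNIV. ennreal (lam i * ((1 - e) * (\<phi> i / h i))))"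
        by (simp only: ennreal_mult'[OF l0])
      also have "\<dots> = ennreal (\<Sum>i\<in>UNIV. lam i * ((1 - e) * (\<phi> i / h i)))"
        using l0 \<phi> h(1) True by (intro sum_ennreal mult_nonneg_nonneg divide_nonneg_pos) (auto simp: less_imp_le)
      also have "(\<Sum>i\<in>UNIV. lam i * ((1 - e) * (\<phi> i / h i))) = (1 - e) * Y"
        unfolding Y_def sum_distrib_left by (intro sum.cong) auto
      finally show ?thesis by simp
    next
      case False
      then have "(1 - e) * Y \<le> 0" using Y by (simp add: mult_le_0_iff)
      then show ?thesis by (simp add: ennreal_neg)
    qed
    also have "\<dots> \<le> (\<Sum>i\<in>UNIV. ennreal (lam i) * (\<integral>\<^sup>+x. ennreal (min (F i x / h i) 1) \<partial>lborel))"
      by (intro sum_mono mult_left_mono lower) auto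
    also have "\<dots> = (\<Sum>i\<in>UNIV. ennreal (lam i) * (\<integral>\<^sup>+ t. indicator {0<..<1} t * emeasure lborel {x. t \<le> F i x / h i} \<partial>lborel))"
      using F(1) h(1) by (subst nn_integral_level_sets) (auto simp: less_imp_le)
    also have "\<dots> = (\<integral>\<^sup>+ t. (\<Sum>i\<in>UNIV. ennreal (lam i) * (indicator {0<..<1} t * emeasure lborel {x. t \<le> F i x / h i})) \<partial>lborel)"
      using meas[of "\<lambda>x. F _ x / h _"] by (simp add: nn_integral_sum nn_integral_cmult)
    also have "\<dots> \<le> (\<integral>\<^sup>+ t. indicator {0<..<1} t * emeasure lborel {z. t \<le> g z} \<partial>lborel)"
      using level by (intro nn_integral_mono) (auto simp: indicator_def)
    also have "\<dots> = (\<integral>\<^sup>+ x. ennreal (min (g x) 1) \<partial>lborel)"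
      using g0 by (intro nn_integral_level_sets) auto
    also have "\<dots> \<le> (\<integral>\<^sup>+ x. ennreal (g x) \<partial>lborel)"
      by (intro nn_integral_mono ennreal_leI) auto
    also have "\<dots> = ennreal ((\<Sum>i\<in>UNIV. v i * b i) / c)"
      using int_g g0 by (simp add: nn_integral_eq_integral)
    finally have "(1 - e) * Y \<le> (\<Sum>i\<in>UNIV. v i * b i) / c"
      using v(1) b c by (subst (asm) ennreal_le_iff) (auto intro!: divide_nonneg_pos sum_nonneg mult_nonneg_nonneg)
    also have "\<dots> \<le> power_mean lam q b / c"
      using v(2) c by (simp add: divide_right_mono)
    \<comment> \<open>This factorisation lets Hoelder's inequality produce the same factor
      \<open>Y\<close> as on the left, so that the heights \<open>h i\<close> disappear from the
      result.\<close>
    also have "power_mean lam q b = power_mean lam q (\<lambda>i. (\<gamma> i / \<phi> i) * (\<phi> i / h i))"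
      using less_imp_neq[OF \<phi>] by (simp add: b_def[abs_def])
    also have "\<dots> \<le> ?R * Y"
      unfolding Y_def \<phi>_def[symmetric] \<gamma>_def[symmetric]
      by (rule power_mean_Hoelder[OF w q]) (use \<gamma> \<phi> h in \<open>auto simp: less_imp_le\<close>)
    finally have "c * (1 - e) * Y \<le> ?R * Y" using c by (simp add: field_simps)
    then show ?thesis using Y by simp
  qed
  show ?thesis
  proof (rule field_le_epsilon)
    fix d :: real assume "0 < d"
    moreover have "c * (1 - d / c) = c - d" using c by (simp add: right_diff_distrib)
    ultimately show "c \<le> ?R + d" using main[of "d / c"] c by simp
  qed
qed

subsection \<open>Induction on the dimension\<close>

interpretation lborel_product: product_sigma_finite "\<lambda>_. lborel :: real measure"
  by standard

lemma PiM_insert_integrable: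
  fixes f :: "('k \<Rightarrow> real) \<Rightarrow> real"
  assumes I: "finite I" "k \<notin> I" and f: "integrable (\<Pi>\<^sub>M _\<in>insert k I. lborel) f"
  shows "AE y in (\<Pi>\<^sub>M _\<in>I. lborel). integrable lborel (\<lambda>s. f (y(k := s)))"
    and "integrable (\<Pi>\<^sub>M _\<in>I. lborel) (\<lambda>y. \<integral>s. f (y(k := s)) \<partial>lborel)"
proof -
  let ?P = "\<Pi>\<^sub>M _\<in>I. lborel :: real measure"
  interpret I: finite_product_sigma_finite "\<lambda>_. lborel :: real measure" I by standard fact
  interpret P: pair_sigma_finite ?P "lborel :: real measure" ..
  have [measurable]: "f \<in> borel_measurable (\<Pi>\<^sub>M _\<in>insert k I. lborel)" using f by auto
  have m: "(\<lambda>(y, s). y(k := s)) \<in> ?P \<Otimes>\<^sub>M lborel \<rightarrow>\<^sub>M (\<Pi>\<^sub>M _\<in>insert k I. lborel)"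
    by (rule measurable_add_dim)
  have mf: "(\<lambda>(y, s). f (y(k := s))) \<in> borel_measurable (?P \<Otimes>\<^sub>M lborel)"
    using measurable_compose[OF m, of f] by (simp add: split_beta')
  have "(\<integral>\<^sup>+z. ennreal (norm (case z of (y, s) \<Rightarrow> f (y(k := s)))) \<partial>(?P \<Otimes>\<^sub>M lborel))
    = (\<integral>\<^sup>+y. \<integral>\<^sup>+s. ennreal (norm (f (y(k := s)))) \<partial>lborel \<partial>?P)"
    using mf by (subst lborel.nn_integral_fst[symmetric]) (auto simp: split_beta')
  also have "\<dots> = (\<integral>\<^sup>+z. ennreal (norm (f z)) \<partial>(\<Pi>\<^sub>M _\<in>insert k I. lborel))"
    by (rule lborel_product.product_nn_integral_insert[symmetric, OF I]) auto
  also have "\<dots> < \<infinity>" using f by (simp add: integrable_iff_bounded)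
  finally have int: "integrable (?P \<Otimes>\<^sub>M lborel) (\<lambda>(y, s). f (y(k := s)))"
    using mf by (simp add: integrable_iff_bounded)
  show "AE y in ?P. integrable lborel (\<lambda>s. f (y(k := s)))"
    using P.AE_integrable_fst'[OF int] by simp
  show "integrable ?P (\<lambda>y. \<integral>s. f (y(k := s)) \<partial>lborel)"
    using P.integrable_fst'[OF int] by simp
qed

lemma PiM_insert_null_section:
  fixes N :: "('k \<Rightarrow> real) set"
  assumes I: "finite I" "k \<notin> I" and N: "N \<in> null_sets (\<Pi>\<^sub>M _\<in>insert k I. lborel)"
  shows "AE y in (\<Pi>\<^sub>M _\<in>I. lborel). {s. y(k := s) \<in> N} \<in> null_sets lborel"
proof -
  let ?P = "\<Pi>\<^sub>M _\<in>I. lborel :: real measure" and ?P' = "\<Pi>\<^sub>M _\<in>insert k I. lborel :: real measure"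
  have [measurable]: "N \<in> sets ?P'" using N by auto
  have m: "(\<lambda>(y, s). indicator N (y(k := s)) :: ennreal) \<in> borel_measurable (?P \<Otimes>\<^sub>M lborel)"
    using measurable_compose[OF measurable_add_dim, of "indicator N :: _ \<Rightarrow> ennreal" k I "\<lambda>_. lborel" borel]
    by (simp add: split_beta')
  have "(\<integral>\<^sup>+y. \<integral>\<^sup>+s. indicator N (y(k := s)) \<partial>lborel \<partial>?P) = (\<integral>\<^sup>+z. indicator N z \<partial>?P')"
    by (rule lborel_product.product_nn_integral_insert[symmetric, OF I]) auto
  also have "\<dots> = 0" using N by (simp add: null_setsD1)
  finally have "AE y in ?P. (\<integral>\<^sup>+s. indicator N (y(k := s)) \<partial>lborel) = 0"
    using lborel.borel_measurable_nn_integral[OF m] by (subst (asm) nn_integral_0_iff_AE) auto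
  then show ?thesis
  proof (rule AE_mp, intro AE_I2 impI)
    fix y assume y: "y \<in> space ?P" and 0: "(\<integral>\<^sup>+s. indicator N (y(k := s)) \<partial>lborel) = 0"
    have "(\<lambda>s. y(k := s)) \<in> lborel \<rightarrow>\<^sub>M ?P'"
      using measurable_component_update[OF y I(2)] by simp
    from measurable_sets[OF this, of N] have s: "{s. y(k := s) \<in> N} \<in> sets lborel"
      by (simp add: vimage_def)
    have "emeasure lborel {s. y(k := s) \<in> N} = (\<integral>\<^sup>+s. indicator {s. y(k := s) \<in> N} s \<partial>lborel)"
      using s by simp
    also have "\<dots> = (\<integral>\<^sup>+s. indicator N (y(k := s)) \<partial>lborel)"
      by (intro nn_integral_cong) (auto simp: indicator_def)
    finally show "{s. y(k := s) \<in> N} \<in> null_sets lborel" using 0 s by auto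
  qed
qed

text \<open>Integrating out one coordinate by the one-dimensional inequality with exponent
  \<open>p\<close> yields the hypothesis for the partial integrals with exponent
  \<open>power_transform 1 p\<close>. Exceptions at the barycentre alone are what makes this
  induction possible: their sections are null for almost every \<open>z\<close>.\<close>

lemma power_mean_ratio_PiM:
  fixes f g :: "'m::finite \<Rightarrow> ('k \<Rightarrow> real) \<Rightarrow> real"
  assumes "finite I" and w: "weight lam" and c: "0 < c"
    and "\<And>n. n < card I \<Longrightarrow> (power_transform 1 ^^ n) p \<le> 1"
    and "\<And>i x. 0 \<le> f i x" "\<And>i. integrable (\<Pi>\<^sub>M _\<in>I. lborel) (f i)"
    and "\<And>i. 0 < (\<integral>x. f i x \<partial>(\<Pi>\<^sub>M _\<in>I. lborel))"
    and "\<And>i x. 0 \<le> g i x" "\<And>i. integrable (\<Pi>\<^sub>M _\<in>I. lborel) (g i)"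
    and "N \<in> null_sets (\<Pi>\<^sub>M _\<in>I. lborel)"
    and "\<And>x z. (\<And>i. x i \<in> space (\<Pi>\<^sub>M _\<in>I. lborel)) \<Longrightarrow> (\<And>i. 0 < f i (x i)) \<Longrightarrow>
      z = (\<lambda>k\<in>I. \<Sum>i\<in>UNIV. lam i * x i k) \<Longrightarrow> z \<notin> N \<Longrightarrow>
      c \<le> power_mean lam p (\<lambda>i. g i z / f i (x i))"
  shows "c \<le> power_mean lam ((power_transform 1 ^^ card I) p)
    (\<lambda>i. (\<integral>x. g i x \<partial>(\<Pi>\<^sub>M _\<in>I. lborel)) / (\<integral>x. f i x \<partial>(\<Pi>\<^sub>M _\<in>I. lborel)))"
  using assms(1,4-)
proof (induction I arbitrary: p f g N rule: finite_induct)
  case (empty p f g N)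
  let ?u = "\<lambda>_. undefined :: real"
  have e: "(\<integral>x. h x \<partial>(\<Pi>\<^sub>M _\<in>{}. lborel)) = h ?u" for h :: "('k \<Rightarrow> real) \<Rightarrow> real"
    by (simp add: PiM_empty lebesgue_integral_count_space_finite)
  \<comment> \<open>The empty product is a single point of mass 1, which no null set
    contains.\<close>
  have "?u \<notin> N"
  proof
    assume "?u \<in> N"
    then have "N = {?u}" using empty.prems(7) by (auto simp: PiM_empty null_sets_def)
    then show False using empty.prems(7) by (simp add: PiM_empty null_sets_def emeasure_count_space_finite)
  qed
  moreover have "0 < f i ?u" for i using empty.prems(4)[of i] by (simp add: e)
  ultimately have "c \<le> power_mean lam p (\<lambda>i. g i ?u / f i ?u)"
    by (intro empty.prems(8)[of "\<lambda>_. ?u"]) (auto simp: PiM_empty)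
  then show ?case by (simp add: e)
next
  case (insert k I p f g N)
  let ?P = "\<Pi>\<^sub>M _\<in>I. lborel :: real measure" and ?P' = "\<Pi>\<^sub>M _\<in>insert k I. lborel :: real measure"
  note I = insert.hyps
  define F G where "F i y = (\<integral>s. f i (y(k := s)) \<partial>lborel)" and "G i y = (\<integral>s. g i (y(k := s)) \<partial>lborel)" for i y
  have F: "(\<integral>x. f i x \<partial>?P') = (\<integral>y. F i y \<partial>?P)" and G: "(\<integral>x. g i x \<partial>?P') = (\<integral>y. G i y \<partial>?P)" for i
    unfolding F_def G_def using insert.prems by (auto intro!: lborel_product.product_integral_insert I)
  \<comment> \<open>These two properties are needed only at the barycentre, so the points where they
    fail can serve as the new exceptional set. For \<open>f\<close> positivity of the partial
    integral will do instead.\<close>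
  have "AE y in ?P. (\<forall>i\<in>UNIV. integrable lborel (\<lambda>s. g i (y(k := s)))) \<and> {s. y(k := s) \<in> N} \<in> null_sets lborel"
    using insert.prems PiM_insert_integrable(1)[OF I] PiM_insert_null_section[OF I]
    by (intro AE_conjI AE_finite_allI) auto
  then obtain N' where N': "N' \<in> null_sets ?P"
    "\<And>y. y \<in> space ?P - N' \<Longrightarrow> (\<forall>i. integrable lborel (\<lambda>s. g i (y(k := s)))) \<and> {s. y(k := s) \<in> N} \<in> null_sets lborel"
    by (rule AE_E3) auto
  have "c \<le> power_mean lam ((power_transform 1 ^^ card I) (power_transform 1 p))
    (\<lambda>i. (\<integral>y. G i y \<partial>?P) / (\<integral>y. F i y \<partial>?P))"
  proof (rule insert.IH)
    show "(power_transform 1 ^^ n) (power_transform 1 p) \<le> 1" if "n < card I" for n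
      using insert.prems(1)[of "Suc n"] that I by (simp add: funpow_swap1)
    show "0 \<le> F i y" "0 \<le> G i y" for i y
      unfolding F_def G_def using insert.prems by auto
    show "integrable ?P (F i)" "integrable ?P (G i)" for i
      unfolding F_def[abs_def] G_def[abs_def] using insert.prems by (auto intro!: PiM_insert_integrable I)
    show "0 < (\<integral>y. F i y \<partial>?P)" for i using insert.prems(4)[of i] F by simp
    show "N' \<in> null_sets ?P" by fact
    fix x :: "'m \<Rightarrow> 'k \<Rightarrow> real" and z
    assume x: "\<And>i. x i \<in> space ?P" and Fx: "\<And>i. 0 < F i (x i)"
      and z: "z = (\<lambda>k\<in>I. \<Sum>i\<in>UNIV. lam i * x i k)" and zN: "z \<notin> N'"
    have "z \<in> space ?P" by (simp add: z space_PiM)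
    with N'(2)[of z] zN have gz: "integrable lborel (\<lambda>s. g i (z(k := s)))"
      and Nz: "{s. z(k := s) \<in> N} \<in> null_sets lborel" for i by auto
    show "c \<le> power_mean lam (power_transform 1 p) (\<lambda>i. G i z / F i (x i))"
      unfolding F_def G_def
    proof (rule power_mean_ratio_one_dim[OF w _ c _ _ _ _ gz Nz])
      show "p \<le> 1" using insert.prems(1)[of 0] I by simp
      \<comment> \<open>A section that is not integrable would have integral 0 by convention,
        contradicting \<open>0 < F i (x i)\<close>.\<close>
      show "integrable lborel (\<lambda>s. f i ((x i)(k := s)))" for i
        using Fx[of i] not_integrable_integral_eq unfolding F_def by force
      show "0 < (\<integral>s. f i ((x i)(k := s)) \<partial>lborel)" for i
        using Fx[of i] unfolding F_def .
      fix s and \<zeta> :: real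
      assume s: "\<And>i. 0 < f i ((x i)(k := s i))" and \<zeta>: "\<zeta> = (\<Sum>i\<in>UNIV. lam i * s i)" "\<zeta> \<notin> {s. z(k := s) \<in> N}"
      show "c \<le> power_mean lam p (\<lambda>i. g i (z(k := \<zeta>)) / f i ((x i)(k := s i)))"
      proof (rule insert.prems(8)[of "\<lambda>i. (x i)(k := s i)"])
        show "(x i)(k := s i) \<in> space ?P'" for i
          using x[of i] by (auto simp: space_PiM PiE_def extensional_def)
        show "z(k := \<zeta>) = (\<lambda>j\<in>insert k I. \<Sum>i\<in>UNIV. lam i * ((x i)(k := s i)) j)"
          using I by (auto simp: z \<zeta> fun_eq_iff restrict_def)
        show "0 < f i ((x i)(k := s i))" for i by (rule s)
        show "z(k := \<zeta>) \<notin> N" using \<zeta>(2) by simp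
      qed
    qed (use insert.prems in auto)
  qed
  then show ?case using I by (simp add: F G funpow_swap1)
qed

subsection \<open>Density points\<close>

text \<open>A fixed fraction \<open>\<delta>\<close> replaces the limit 1 of the usual density,
  since only 2m sets will have to be intersected. The strict inequality makes the condition open in
  \<open>x\<close>.\<close>

definition dense_in_ball :: "real \<Rightarrow> 'a::euclidean_space set \<Rightarrow> real \<Rightarrow> 'a \<Rightarrow> bool" where
  "dense_in_ball \<delta> A r x \<longleftrightarrow>
    (1 - \<delta>) * measure lebesgue (ball x r) < measure lebesgue (A \<inter> ball x r)"

text \<open>A slightly smaller ball \<open>ball x s\<close> loses less volume than the slack in the
  strict inequality, and it lies in \<open>ball y r\<close> for all \<open>y\<close> near
  \<open>x\<close>.\<close>

lemma open_dense_in_ball: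
  fixes A :: "'a::euclidean_space set"
  assumes A: "A \<in> sets lebesgue" and r: "0 < r"
  shows "open {x. dense_in_ball \<delta> A r x}"
  unfolding open_dist
proof
  fix x assume "x \<in> {x. dense_in_ball \<delta> A r x}"
  then have x: "dense_in_ball \<delta> A r x" by simp
  define V where "V s = unit_ball_vol (real DIM('a)) * s ^ DIM('a)" for s :: real
  have V: "measure lborel (ball y s) = V s" if "0 \<le> s" for y :: 'a and s
    using content_ball[OF that, of y] by (simp add: V_def)
  define gap where "gap = measure lebesgue (A \<inter> ball x r) - (1 - \<delta>) * V r"
  have gap: "0 < gap" using x r by (simp add: dense_in_ball_def V gap_def)
  have "(V \<longlongrightarrow> V r) (at_left r)"
    unfolding V_def by (intro tendsto_intros)
  then have "\<forall>\<^sub>F s in at_left r. V r - gap < V s"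
    using gap by (intro order_tendstoD(1)) auto
  moreover have "\<forall>\<^sub>F s in at_left r. 0 < s" using r
    by (simp add: eventually_at_left_field) (metis r)
  moreover have "\<forall>\<^sub>F s in at_left r. s < r" by (simp add: eventually_at_filter)
  ultimately have "\<forall>\<^sub>F s in at_left r. V r - gap < V s \<and> 0 < s \<and> s < r"
    by eventually_elim auto
  then obtain s where s: "V r - gap < V s" "0 < s" "s < r"
    using eventually_happens' trivial_limit_at_left_real by blast
  show "\<exists>e>0. \<forall>y. dist y x < e \<longrightarrow> y \<in> {x. dense_in_ball \<delta> A r x}"
  proof (intro exI conjI allI impI CollectI)
    show "0 < r - s" using s by simp
    fix y assume "dist y x < r - s"
    then have sub: "ball x s \<subseteq> ball y r"
      by (intro subsetI) (smt (verit) dist_commute dist_triangle mem_ball)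
    have m: "A \<inter> ball z t \<in> lmeasurable" for z t
      using A by (intro bounded_set_imp_lmeasurable) (auto intro: bounded_subset[OF bounded_ball])
    have "measure lebesgue (A \<inter> ball x r) \<le> measure lebesgue (A \<inter> ball x s \<union> (ball x r - ball x s))"
      using m by (intro measure_mono_fmeasurable fmeasurable.Un fmeasurable.Diff) (auto intro: fmeasurableD)
    also have "\<dots> \<le> measure lebesgue (A \<inter> ball x s) + measure lebesgue (ball x r - ball x s)"
      using m by (intro measure_Un_le) auto
    also have "measure lebesgue (ball x r - ball x s) = V r - V s"
      using s by (subst measurable_measure_Diff) (auto simp: V)
    also have "measure lebesgue (A \<inter> ball x s) \<le> measure lebesgue (A \<inter> ball y r)"
      using m sub by (intro measure_mono_fmeasurable) (auto intro: fmeasurableD)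
    finally show "dense_in_ball \<delta> A r y"
      using s r by (simp add: dense_in_ball_def V gap_def)
  qed
qed

text \<open>In a Vitali covering of the exceptional set by balls in which
  \<open>A\<close> is not dense, the part of \<open>A\<close> inside the balls has only \<open>1 - \<delta>\<close> times their volume, so the
  outer measure of the exceptional set is at most \<open>1 - \<delta>\<close> times itself.\<close>

lemma lebesgue_density:
  fixes A :: "'a::euclidean_space set"
  assumes A: "A \<in> sets lebesgue" and \<delta>: "0 < \<delta>" "\<delta> \<le> 1"
  shows "negligible {x \<in> A. \<not> (\<forall>\<^sub>F r in at_right 0. dense_in_ball \<delta> A r x)}"
proof -
  let ?\<mu> = "measure lebesgue"
  define E where "E = {x \<in> A. \<not> (\<forall>\<^sub>F r in at_right 0. dense_in_ball \<delta> A r x)}"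
  have E: "\<exists>r. 0 < r \<and> r < d \<and> \<not> dense_in_ball \<delta> A r x" if "x \<in> E" "0 < d" for x d
    using that unfolding E_def eventually_at_right_field by (auto; metis)
  have "negligible (E \<inter> ball 0 (real n))" for n :: nat
  proof -
    define S where "S = E \<inter> ball 0 (real n)"
    \<comment> \<open>Outer measure through open supersets, as measurability of \<open>S\<close> is
      not established; cutting with a ball keeps it finite.\<close>
    define \<U> where "\<U> = {U. open U \<and> U \<in> lmeasurable \<and> S \<subseteq> U}"
    define \<alpha> where "\<alpha> = Inf (?\<mu> ` \<U>)"
    have "ball 0 (real n) \<in> \<U>" by (auto simp: \<U>_def S_def)
    then have ne: "?\<mu> ` \<U> \<noteq> {}" by blast
    have bdd: "bdd_below (?\<mu> ` \<U>)" by (rule bdd_belowI[of _ 0]) auto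
    have step: "\<alpha> \<le> (1 - \<delta>) * (\<alpha> + e) + e" if e: "0 < e" for e
    proof -
      obtain U where U: "open U" "U \<in> lmeasurable" "S \<subseteq> U" "?\<mu> U < \<alpha> + e"
        using cInf_lessD[OF ne, of "\<alpha> + e"] e unfolding \<alpha>_def \<U>_def by auto
      define K where "K = {(x, r). 0 < r \<and> ball x r \<subseteq> U \<and> \<not> dense_in_ball \<delta> A r x}"
      have cov: "\<exists>i. i \<in> K \<and> x \<in> ball (fst i) (snd i) \<and> snd i < d" if x: "x \<in> S" and d: "0 < d" for x d
      proof -
        obtain t where t: "0 < t" "ball x t \<subseteq> U" using openE[OF U(1), of x] U(3) x by auto
        obtain r where r: "0 < r" "r < min d t" "\<not> dense_in_ball \<delta> A r x"
          using E[of x "min d t"] x d t by (auto simp: S_def)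
        then show ?thesis
          using t by (intro exI[of _ "(x, r)"]) (auto simp: K_def)
      qed
      obtain C where C: "countable C" "C \<subseteq> K"
        "pairwise (\<lambda>i j. disjnt (ball (fst i) (snd i)) (ball (fst j) (snd j))) C"
        "negligible (S - (\<Union>i\<in>C. ball (fst i) (snd i)))"
        by (rule Vitali_covering_theorem_balls[of S K fst snd, OF cov])
      have disj: "disjoint_family_on (\<lambda>i. ball (fst i) (snd i)) C"
        using C(3) by (auto simp: disjoint_family_on_def pairwise_def disjnt_def)
      then have disjA: "disjoint_family_on (\<lambda>i. A \<inter> ball (fst i) (snd i)) C"
        unfolding disjoint_family_on_def by blast
      have mb: "A \<inter> ball z t \<in> lmeasurable" for z t
        using A by (intro bounded_set_imp_lmeasurable) (auto intro: bounded_subset[OF bounded_ball])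
      \<comment> \<open>\<open>S\<close> lies in \<open>A\<close>, so it is covered by the part
        \<open>T\<close> of the balls inside \<open>A\<close> together with the null remainder
        \<open>Z\<close>. An open superset \<open>W\<close> of \<open>T \<union> Z\<close> then
        competes in the infimum \<open>\<alpha>\<close>.\<close>
      define T where "T = (\<Union>i\<in>C. A \<inter> ball (fst i) (snd i))"
      define Z where "Z = S - (\<Union>i\<in>C. ball (fst i) (snd i))"
      have Z: "Z \<in> null_sets lebesgue" using C(4) by (simp add: Z_def negligible_iff_null_sets)
      have T: "T \<in> sets lebesgue"
        unfolding T_def using C(1) A by (intro sets.countable_UN'') auto
      have "emeasure lebesgue (T \<union> Z) = emeasure lebesgue T"
        using Z T by (intro emeasure_Un_null_set) auto
      also have "\<dots> = (\<integral>\<^sup>+i. emeasure lebesgue (A \<inter> ball (fst i) (snd i)) \<partial>count_space C)"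
        unfolding T_def using A by (intro emeasure_UN_countable C(1) disjA) auto
      also have "\<dots> \<le> (\<integral>\<^sup>+i. ennreal (1 - \<delta>) * emeasure lebesgue (ball (fst i) (snd i)) \<partial>count_space C)"
      proof (intro nn_integral_mono)
        fix i assume "i \<in> space (count_space C)"
        then have "?\<mu> (A \<inter> ball (fst i) (snd i)) \<le> (1 - \<delta>) * ?\<mu> (ball (fst i) (snd i))"
          using C(2) by (auto simp: K_def dense_in_ball_def not_less)
        then show "emeasure lebesgue (A \<inter> ball (fst i) (snd i)) \<le> ennreal (1 - \<delta>) * emeasure lebesgue (ball (fst i) (snd i))"
          using mb \<delta> by (simp add: emeasure_eq_measure2 flip: ennreal_mult')
      qed
      also have "\<dots> = ennreal (1 - \<delta>) * emeasure lebesgue (\<Union>i\<in>C. ball (fst i) (snd i))"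
        by (subst emeasure_UN_countable[OF _ C(1) disj]) (auto simp: nn_integral_cmult)
      also have "\<dots> \<le> ennreal (1 - \<delta>) * emeasure lebesgue U"
        using C(2) U by (intro mult_left_mono emeasure_mono UN_least) (auto simp: K_def subset_iff)
      also have "\<dots> = ennreal ((1 - \<delta>) * ?\<mu> U)"
        using U \<delta> by (simp add: emeasure_eq_measure2 ennreal_mult')
      finally have TZ: "emeasure lebesgue (T \<union> Z) \<le> ennreal ((1 - \<delta>) * ?\<mu> U)" .
      obtain W where W: "open W" "T \<union> Z \<subseteq> W" "W - (T \<union> Z) \<in> lmeasurable" "emeasure lebesgue (W - (T \<union> Z)) < ennreal e"
        using sets_lebesgue_outer_open[of "T \<union> Z" e] T Z e by auto
      have "emeasure lebesgue W = emeasure lebesgue ((T \<union> Z) \<union> (W - (T \<union> Z)))"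
        using W(2) by (simp only: Un_Diff_cancel Un_absorb1)
      also have "\<dots> = emeasure lebesgue (T \<union> Z) + emeasure lebesgue (W - (T \<union> Z))"
        using W T Z by (intro plus_emeasure[symmetric]) (auto intro: fmeasurableD)
      also have "\<dots> \<le> ennreal ((1 - \<delta>) * ?\<mu> U) + ennreal e"
        using TZ W(4) by (intro add_mono) auto
      also have "\<dots> = ennreal ((1 - \<delta>) * ?\<mu> U + e)"
        using \<delta> e by (subst ennreal_plus) auto
      finally have eW: "emeasure lebesgue W \<le> ennreal ((1 - \<delta>) * ?\<mu> U + e)" .
      then have Wl: "W \<in> lmeasurable"
        using W(1) by (intro fmeasurableI) (auto simp: order.strict_trans1)
      have "S \<subseteq> W"
        using W(2) by (auto simp: T_def Z_def S_def E_def)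
      then have "\<alpha> \<le> ?\<mu> W"
        unfolding \<alpha>_def using W(1) Wl bdd by (intro cInf_lower) (auto simp: \<U>_def)
      also have "\<dots> \<le> (1 - \<delta>) * ?\<mu> U + e"
      proof -
        have "ennreal (?\<mu> W) \<le> ennreal ((1 - \<delta>) * ?\<mu> U + e)"
          using eW by (simp only: emeasure_eq_measure2[OF Wl])
        moreover have "0 \<le> (1 - \<delta>) * ?\<mu> U + e" using \<delta> e by simp
        ultimately show ?thesis by (simp only: ennreal_le_iff)
      qed
      also have "\<dots> \<le> (1 - \<delta>) * (\<alpha> + e) + e"
        using U(4) \<delta> by (intro add_right_mono mult_left_mono) auto
      finally show ?thesis .
    qed
    have "\<alpha> \<le> 0"
    proof (rule field_le_epsilon)
      fix e' :: real assume e': "0 < e'"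
      \<comment> \<open>The bound \<open>step\<close> says
        \<open>\<delta> * (\<alpha> + e) \<le> 2 * e\<close>; this choice makes the right side
        \<open>\<delta> * e'\<close>.\<close>
      define e where "e = \<delta> * e' / 2"
      have e: "0 < e" "2 * e = \<delta> * e'" using e' \<delta> by (auto simp: e_def)
      have "\<delta> * \<alpha> + \<delta> * e \<le> 2 * e" using step[OF e(1)] by (simp add: algebra_simps)
      moreover have "0 < \<delta> * e" using e(1) \<delta> by simp
      ultimately have "\<delta> * \<alpha> \<le> \<delta> * e'" using e(2) by linarith
      then show "\<alpha> \<le> 0 + e'" using \<delta> by (simp add: mult_le_cancel_left_pos)
    qed
    have "\<exists>T. S \<subseteq> T \<and> T \<in> lmeasurable \<and> ?\<mu> T \<le> e" if "0 < e" for e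
    proof -
      have "Inf (?\<mu> ` \<U>) < e" using \<open>\<alpha> \<le> 0\<close> that by (simp add: \<alpha>_def)
      then obtain U where "U \<in> \<U>" "?\<mu> U < e" using cInf_lessD[OF ne] by blast
      then show ?thesis by (intro exI[of _ U]) (simp add: \<U>_def)
    qed
    then show ?thesis unfolding S_def negligible_outer_le by blast
  qed
  then have "negligible (\<Union>n. E \<inter> ball 0 (real n))" by (rule negligible_Union_nat)
  moreover have "(\<Union>n. E \<inter> ball 0 (real n)) = E"
    using reals_Archimedean2 by auto
  ultimately show ?thesis by (simp add: E_def)
qed

section \<open>Null sets under translations and projections\<close>

lemma nn_integral_translates:
  fixes E :: "'b::euclidean_space set" and L :: "'a::euclidean_space \<Rightarrow> 'b"
  assumes [measurable]: "E \<in> sets borel" "L \<in> borel_measurable borel"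
  shows "(\<integral>\<^sup>+x. \<integral>\<^sup>+w. indicator E (x + L w) \<partial>lborel \<partial>lborel) = emeasure lborel E * emeasure (lborel :: 'a measure) UNIV"
proof -
  have "(\<integral>\<^sup>+x. \<integral>\<^sup>+w. indicator E (x + L w) \<partial>lborel \<partial>lborel) = (\<integral>\<^sup>+w. \<integral>\<^sup>+x. indicator E (x + L w) \<partial>lborel \<partial>lborel)"
    by (rule lborel_pair.Fubini'[symmetric]) measurable
  also have "\<dots> = (\<integral>\<^sup>+w. emeasure lborel E \<partial>(lborel :: 'a measure))"
  proof (rule nn_integral_cong)
    fix w
    have "(\<integral>\<^sup>+x. indicator E (x + L w) \<partial>lborel) = (\<integral>\<^sup>+x. indicator E x \<partial>distr lborel borel ((+) (L w)))"
      by (subst nn_integral_distr) (auto simp: add.commute)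
    then show "(\<integral>\<^sup>+x. indicator E (x + L w) \<partial>lborel) = emeasure lborel E"
      by (simp add: lborel_distr_plus)
  qed
  finally show ?thesis by simp
qed

text \<open>Averaging over translations: for fixed \<open>w\<close> the translate of a null set is
  null, so Tonelli's theorem applies. With the diagonal embedding as \<open>L\<close>, almost every
  tuple can be shifted diagonally by almost every \<open>w\<close> without meeting an
  exception.\<close>

lemma AE_translates:
  fixes L :: "'a::euclidean_space \<Rightarrow> 'b::euclidean_space"
  assumes P: "AE x in lborel. P x" and [measurable]: "L \<in> borel_measurable borel"
  shows "AE x in lborel. AE w in lborel. P (x + L w)"
proof -
  from P obtain N where N: "\<And>x. x \<notin> N \<Longrightarrow> P x" "N \<in> null_sets lborel"
    by (rule AE_E3) auto
  then have [measurable]: "N \<in> sets borel" by auto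
  have "(\<integral>\<^sup>+x. \<integral>\<^sup>+w. indicator N (x + L w) \<partial>lborel \<partial>lborel) = 0"
    using N(2) by (subst nn_integral_translates) auto
  then have "AE x in lborel. (\<integral>\<^sup>+w. indicator N (x + L w) \<partial>lborel) = 0"
    by (subst (asm) nn_integral_0_iff_AE) measurable
  then show ?thesis
  proof (rule eventually_mono)
    fix x assume "(\<integral>\<^sup>+w. indicator N (x + L w) \<partial>lborel) = 0"
    then have "AE w in lborel. indicator N (x + L w) = (0 :: ennreal)"
      by (subst (asm) nn_integral_0_iff_AE) measurable
    then show "AE w in lborel. P (x + L w)"
      by eventually_elim (auto simp: indicator_def N(1) split: if_splits)
  qed
qed

text \<open>Beyond Borel measurability, preimages of null sets must be null. The preimage
  \<open>E\<close> of \<open>N\<close> meets every translate of the i-th factor in a translate of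
  \<open>N\<close>, so averaging over shifts along that factor gives measure of \<open>E\<close>
  times infinity equal to 0.\<close>

lemma lebesgue_measurable_nth: "(\<lambda>x :: 'a::euclidean_space ^ 'm. x $ i) \<in> lebesgue \<rightarrow>\<^sub>M lebesgue"
proof (rule completion.measurable_completion2)
  have [measurable]: "(\<lambda>x :: 'a ^ 'm. x $ i) \<in> borel_measurable borel"
    by (intro borel_measurable_continuous_onI continuous_intros)
  show m: "(\<lambda>x :: 'a ^ 'm. x $ i) \<in> lebesgue \<rightarrow>\<^sub>M lborel" by (intro measurable_completion) simp
  show "null_sets lborel \<subseteq> null_sets (distr lebesgue lborel (\<lambda>x :: 'a ^ 'm. x $ i))"
  proof
    fix N :: "'a set" assume N: "N \<in> null_sets lborel"
    then have [measurable]: "N \<in> sets borel" by auto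
    define E where "E = {x :: 'a ^ 'm. x $ i \<in> N}"
    have E[measurable]: "E \<in> sets borel" unfolding E_def by simp
    have ax: "axis i \<in> borel_measurable (borel :: 'a measure)"
    proof (intro borel_measurable_continuous_onI)
      have "continuous_on UNIV (\<lambda>x :: 'a. if j = i then x else 0)" for j
        by (cases "j = i") auto
      then show "continuous_on UNIV (axis i :: 'a \<Rightarrow> 'a ^ 'm)"
        unfolding axis_def by (intro continuous_on_vec_lambda)
    qed
    have "emeasure lborel E * emeasure (lborel :: 'a measure) UNIV
      = (\<integral>\<^sup>+x. \<integral>\<^sup>+w. indicator E (x + axis i w) \<partial>lborel \<partial>lborel)"
      by (rule nn_integral_translates[symmetric, OF E ax])
    also have "\<dots> = (\<integral>\<^sup>+x. 0 \<partial>(lborel :: ('a ^ 'm) measure))"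
    proof (rule nn_integral_cong)
      fix x :: "'a ^ 'm"
      have "(\<integral>\<^sup>+w. indicator E (x + axis i w) \<partial>lborel) = (\<integral>\<^sup>+w. indicator N (w + x $ i) \<partial>lborel)"
        by (intro nn_integral_cong) (auto simp: E_def indicator_def add.commute)
      also have "\<dots> = (\<integral>\<^sup>+w. indicator N w \<partial>distr lborel borel ((+) (x $ i)))"
        by (subst nn_integral_distr) (auto simp: add.commute)
      also have "\<dots> = 0" using N by (simp add: lborel_distr_plus null_setsD1)
      finally show "(\<integral>\<^sup>+w. indicator E (x + axis i w) \<partial>lborel) = 0" .
    qed
    finally have "emeasure lborel E = 0" by (simp add: emeasure_lborel_UNIV)
    then show "N \<in> null_sets (distr lebesgue lborel (\<lambda>x :: 'a ^ 'm. x $ i))"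
      using m by (auto simp: null_sets_def emeasure_distr E_def vimage_def)
  qed
qed

text \<open>As the weights sum to 1, a diagonal translation moves the barycentre by the same vector
  as the m points, so one \<open>w\<close> can be tested against all 2m level sets.\<close>

lemma bary_add_const:
  fixes x :: "real ^ 'd ^ 'm::finite"
  assumes "weight lam"
  shows "bary lam (x + (\<chi> i. w)) = bary lam x + w"
  using assms by (simp add: bary_def weight_def scaleR_add_right sum.distrib flip: scaleR_sum_left)

lemma continuous_on_bary: "continuous_on S (bary lam)"
  unfolding bary_def[abs_def] by (intro continuous_intros)

text \<open>Off the null set \<open>N\<close> every point is a density point of its level sets. For \<open>y\<close> close to \<open>x\<close>,
  the \<open>2m\<close> level sets through the \<open>x\<^sub>i\<close> and through the barycentre leave room for a common diagonal
  translation \<open>w\<close>, so that \<open>y + (w, \<dots>, w)\<close> has the same values as \<open>x\<close> but avoids the exceptional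
  set of \<open>R\<close>.\<close>

lemma AE_imp_pointwise:
  fixes f g :: "'m::finite \<Rightarrow> real ^ 'd \<Rightarrow> real"
  assumes w: "weight lam"
    and f: "\<And>i. f i \<in> borel_measurable lebesgue" "\<And>i. countable (range (f i))"
    and g: "\<And>i. g i \<in> borel_measurable lebesgue" "\<And>i. countable (range (g i))"
    and R: "AE x in lborel. R (\<lambda>i. g i (bary lam x)) (\<lambda>i. f i (x $ i))"
  shows "\<exists>N\<in>null_sets lborel. \<forall>x. (\<forall>i. x $ i \<notin> N) \<and> bary lam x \<notin> N \<longrightarrow>
    R (\<lambda>i. g i (bary lam x)) (\<lambda>i. f i (x $ i))"
proof -
  let ?\<mu> = "measure lebesgue"
  \<comment> \<open>2m sets, each smaller than the fraction \<open>\<delta>\<close> of a ball,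
    cannot cover it.\<close>
  define \<delta> where "\<delta> = 1 / (2 * real CARD('m))"
  have "0 < CARD('m)" by simp
  then have card: "1 \<le> real CARD('m)" by linarith
  have "\<delta> \<le> 1" unfolding \<delta>_def using card by (subst divide_le_eq_1_pos) linarith+
  then have \<delta>: "0 < \<delta>" "\<delta> \<le> 1" "2 * real CARD('m) * \<delta> = 1"
    by (auto simp: \<delta>_def)
  define bad where "bad h = {x. \<not> (\<forall>\<^sub>F r in at_right 0. dense_in_ball \<delta> {y. h y = h x} r x)}"
    for h :: "real ^ 'd \<Rightarrow> real"
  have lev: "{y. h y = v} \<in> sets lebesgue" if "h \<in> borel_measurable lebesgue" for h :: "real ^ 'd \<Rightarrow> real" and v
    using lebesgue_measurable_vimage_borel[OF that, of "{v}"] by simp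
  have bad: "negligible (bad h)" if "h \<in> borel_measurable lebesgue" "countable (range h)" for h
  proof -
    \<comment> \<open>Countability of the range is used here: the density theorem gives one null set
      for each value.\<close>
    have "bad h = (\<Union>v\<in>range h. {x \<in> {y. h y = v}. \<not> (\<forall>\<^sub>F r in at_right 0. dense_in_ball \<delta> {y. h y = v} r x)})"
      by (auto simp: bad_def)
    moreover have "negligible \<dots>"
      using that lebesgue_density[OF lev[OF that(1)] \<delta>(1,2)] by (intro negligible_countable_Union) auto
    ultimately show ?thesis by simp
  qed
  have "negligible ((\<Union>i. bad (f i)) \<union> (\<Union>i. bad (g i)))"
    using f g bad by (intro negligible_Un negligible_Union) auto
  then obtain N where N: "N \<in> null_sets lborel" "(\<Union>i. bad (f i)) \<union> (\<Union>i. bad (g i)) \<subseteq> N"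
    by (auto simp: negligible_iff_null_sets null_sets_completion_iff2)
  show ?thesis
  proof (intro bexI[OF _ N(1)] allI impI)
    fix x :: "real ^ 'd ^ 'm"
    assume "(\<forall>i. x $ i \<notin> N) \<and> bary lam x \<notin> N"
    then have xN: "\<And>i. x $ i \<notin> N" and zN: "bary lam x \<notin> N" by auto
    define A where "A i = {y. f i y = f i (x $ i)}" for i
    define B where "B i = {y. g i y = g i (bary lam x)}" for i
    have AB[measurable]: "A i \<in> sets lebesgue" "B i \<in> sets lebesgue" for i
      unfolding A_def B_def using lev f g by auto
    have nb: "x $ i \<notin> bad (f i)" "bary lam x \<notin> bad (g i)" for i
      using xN zN N(2) by blast+
    have "\<forall>\<^sub>F r in at_right 0. \<forall>i. dense_in_ball \<delta> (A i) r (x $ i)"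
      using nb(1) by (intro eventually_all_finite) (auto simp: bad_def A_def)
    moreover have "\<forall>\<^sub>F r in at_right 0. \<forall>i. dense_in_ball \<delta> (B i) r (bary lam x)"
      using nb(2) by (intro eventually_all_finite) (auto simp: bad_def B_def)
    moreover have "\<forall>\<^sub>F r :: real in at_right 0. 0 < r" by (simp add: eventually_at_filter)
    ultimately have ev: "\<forall>\<^sub>F r in at_right 0. 0 < r \<and> (\<forall>i. dense_in_ball \<delta> (A i) r (x $ i)) \<and> (\<forall>i. dense_in_ball \<delta> (B i) r (bary lam x))"
      by eventually_elim auto
    obtain r where r: "0 < r" "\<And>i. dense_in_ball \<delta> (A i) r (x $ i)" "\<And>i. dense_in_ball \<delta> (B i) r (bary lam x)"
      using eventually_happens'[OF _ ev] by auto
    \<comment> \<open>\<open>x\<close> itself may belong to the null set of tuples whose diagonal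
      translates misbehave. The density conditions are open, so they persist on a neighbourhood,
      which is too large to lie in that null set.\<close>
    define W where "W = (\<Inter>i. (\<lambda>y. y $ i) -` {x. dense_in_ball \<delta> (A i) r x}) \<inter> (\<Inter>i. bary lam -` {x. dense_in_ball \<delta> (B i) r x})"
    have "open W"
      unfolding W_def using r(1) AB
      by (intro open_Int open_INT ballI open_vimage open_dense_in_ball continuous_on_bary continuous_intros) auto
    moreover have "x \<in> W" using r by (auto simp: W_def)
    ultimately have "\<not> negligible W" using open_not_negligible by auto
    have "AE y in lborel. AE w in lborel. R (\<lambda>i. g i (bary lam (y + (\<chi> i. w)))) (\<lambda>i. f i ((y + (\<chi> i. w)) $ i))"
      by (intro AE_translates[OF R] borel_measurable_continuous_onI continuous_on_vec_lambda continuous_intros)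
    then obtain M where M: "M \<in> null_sets lborel"
      "\<And>y. y \<notin> M \<Longrightarrow> AE w in lborel. R (\<lambda>i. g i (bary lam (y + (\<chi> i. w)))) (\<lambda>i. f i ((y + (\<chi> i. w)) $ i))"
      by (rule AE_E3) auto
    have "negligible M" using M(1) by (simp add: negligible_iff_null_sets null_sets_completionI)
    with \<open>\<not> negligible W\<close> obtain y where y: "y \<in> W" "y \<notin> M"
      using negligible_subset by blast
    have "AE w in lborel. R (\<lambda>i. g i (bary lam y + w)) (\<lambda>i. f i (y $ i + w))"
      using M(2)[OF y(2)] by (simp add: bary_add_const[OF w])
    then obtain M' where M': "M' \<in> null_sets lborel"
      "\<And>w. w \<notin> M' \<Longrightarrow> R (\<lambda>i. g i (bary lam y + w)) (\<lambda>i. f i (y $ i + w))"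
      by (rule AE_E3) auto
    \<comment> \<open>The translations shorter than \<open>r\<close> that push \<open>y $ i\<close>,
      respectively the barycentre of \<open>y\<close>, off the level set belonging to
      \<open>x\<close>.\<close>
    define X Y where "X i = (\<lambda>u. u - y $ i) ` (ball (y $ i) r - A i)"
      and "Y i = (\<lambda>u. u - bary lam y) ` (ball (bary lam y) r - B i)" for i
    have small: "?\<mu> ((\<lambda>u. u - a) ` (ball a r - D)) < \<delta> * ?\<mu> (ball (0 :: real ^ 'd) r)" "(\<lambda>u. u - a) ` (ball a r - D) \<in> lmeasurable"
      if D: "D \<in> sets lebesgue" and dense: "dense_in_ball \<delta> D r a" for a :: "real ^ 'd" and D
    proof -
      have m: "D \<inter> ball a r \<in> lmeasurable"
        using D by (intro bounded_set_imp_lmeasurable) (auto intro: bounded_subset[OF bounded_ball])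
      have eq: "ball a r - D = ball a r - (D \<inter> ball a r)" by auto
      show "(\<lambda>u. u - a) ` (ball a r - D) \<in> lmeasurable"
        unfolding eq using m by (intro measurable_translation_subtract fmeasurable.Diff) (auto intro: fmeasurableD)
      have "?\<mu> ((\<lambda>u. u - a) ` (ball a r - D)) = ?\<mu> (ball a r) - ?\<mu> (D \<inter> ball a r)"
        unfolding measure_translation_subtract eq using m by (intro measurable_measure_Diff) (auto intro: fmeasurableD)
      also have "\<dots> < \<delta> * ?\<mu> (ball a r)"
        using dense by (simp add: dense_in_ball_def algebra_simps)
      also have "?\<mu> (ball a r) = ?\<mu> (ball (0 :: real ^ 'd) r)"
        using r(1) by (simp add: content_ball)
      finally show "?\<mu> ((\<lambda>u. u - a) ` (ball a r - D)) < \<delta> * ?\<mu> (ball (0 :: real ^ 'd) r)" .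
    qed
    have yd: "dense_in_ball \<delta> (A i) r (y $ i)" "dense_in_ball \<delta> (B i) r (bary lam y)" for i
      using y(1) by (auto simp: W_def)
    have X: "?\<mu> (X i) < \<delta> * ?\<mu> (ball (0 :: real ^ 'd) r)" "X i \<in> lmeasurable"
      and Y: "?\<mu> (Y i) < \<delta> * ?\<mu> (ball (0 :: real ^ 'd) r)" "Y i \<in> lmeasurable" for i
      unfolding X_def Y_def
      by (rule small(1)[OF AB(1) yd(1)] small(2)[OF AB(1) yd(1)] small(1)[OF AB(2) yd(2)] small(2)[OF AB(2) yd(2)])+
    have M'n: "M' \<in> null_sets lebesgue" using M'(1) by (rule null_sets_completionI)
    have fm: "M' \<in> lmeasurable" "(\<Union>i. X i) \<in> lmeasurable" "(\<Union>i. Y i) \<in> lmeasurable"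
      using M'n X(2) Y(2) by (auto simp: null_sets_def intro!: fmeasurable.finite_UN fmeasurableI[of M'])
    have "\<exists>w \<in> ball (0 :: real ^ 'd) r. w \<notin> M' \<and> (\<forall>i. w \<notin> X i) \<and> (\<forall>i. w \<notin> Y i)"
    proof (rule ccontr)
      assume "\<not> ?thesis"
      then have "ball (0 :: real ^ 'd) r \<subseteq> M' \<union> ((\<Union>i. X i) \<union> (\<Union>i. Y i))" by blast
      then have "?\<mu> (ball (0 :: real ^ 'd) r) \<le> ?\<mu> (M' \<union> ((\<Union>i. X i) \<union> (\<Union>i. Y i)))"
        by (rule measure_mono_fmeasurable) (use fm in auto)
      also have "\<dots> \<le> ?\<mu> M' + ?\<mu> ((\<Union>i. X i) \<union> (\<Union>i. Y i))"
        using fm by (intro measure_Un_le) (auto intro: fmeasurableD)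
      also have "\<dots> \<le> ?\<mu> M' + (?\<mu> (\<Union>i. X i) + ?\<mu> (\<Union>i. Y i))"
        using fm by (intro add_left_mono measure_Un_le) (auto intro: fmeasurableD)
      also have "?\<mu> M' = 0" using M'n by (simp add: measure_eq_0_null_sets)
      also have "0 + (?\<mu> (\<Union>i. X i) + ?\<mu> (\<Union>i. Y i)) \<le> 0 + ((\<Sum>i\<in>UNIV. ?\<mu> (X i)) + (\<Sum>i\<in>UNIV. ?\<mu> (Y i)))"
        by (intro add_left_mono add_mono measure_UNION_le finite fmeasurableD X(2) Y(2))
      also have "\<dots> < (\<Sum>i\<in>(UNIV::'m set). \<delta> * ?\<mu> (ball (0 :: real ^ 'd) r)) + (\<Sum>i\<in>(UNIV::'m set). \<delta> * ?\<mu> (ball (0 :: real ^ 'd) r))"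
        using X Y by (simp only: add_0) (intro add_strict_mono sum_strict_mono, auto)
      also have "\<dots> = (2 * real CARD('m) * \<delta>) * ?\<mu> (ball (0 :: real ^ 'd) r)" by simp
      also have "\<dots> = ?\<mu> (ball (0 :: real ^ 'd) r)" by (simp only: \<delta>(3) mult_1)
      finally show False by simp
    qed
    then obtain w where w: "w \<in> ball (0 :: real ^ 'd) r" "w \<notin> M'" "\<And>i. w \<notin> X i" "\<And>i. w \<notin> Y i" by blast
    have "f i (y $ i + w) = f i (x $ i)" for i
    proof (rule ccontr)
      assume "f i (y $ i + w) \<noteq> f i (x $ i)"
      then have "y $ i + w \<in> ball (y $ i) r - A i" using w(1) by (auto simp: A_def dist_norm)
      then have "w \<in> X i" unfolding X_def by (intro image_eqI[of _ _ "y $ i + w"]) auto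
      with w show False by blast
    qed
    moreover have "g i (bary lam y + w) = g i (bary lam x)" for i
    proof (rule ccontr)
      assume "g i (bary lam y + w) \<noteq> g i (bary lam x)"
      then have "bary lam y + w \<in> ball (bary lam y) r - B i" using w(1) by (auto simp: B_def dist_norm)
      then have "w \<in> Y i" unfolding Y_def by (intro image_eqI[of _ _ "bary lam y + w"]) auto
      with w show False by blast
    qed
    ultimately show "R (\<lambda>i. g i (bary lam x)) (\<lambda>i. f i (x $ i))"
      using M'(2)[OF w(2)] by simp
  qed
qed

subsection \<open>Rounding and conclusion\<close>

lemma measurable_vec_lambda_PiM:
  "(\<lambda>y. \<chi> k. y k) \<in> (\<Pi>\<^sub>M _\<in>(UNIV :: 'd::finite set). lborel) \<rightarrow>\<^sub>M (borel :: (real ^ 'd) measure)"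
proof (rule borel_measurable_euclidean_space[THEN iffD2], intro ballI)
  fix b :: "real ^ 'd" assume "b \<in> Basis"
  then obtain k where "b = axis k 1" by (auto simp: Basis_vec_def)
  then show "(\<lambda>y. (\<chi> k. y k) \<bullet> b) \<in> borel_measurable (\<Pi>\<^sub>M _\<in>(UNIV :: 'd set). lborel)"
    by (simp add: inner_axis)
qed

lemma lborel_vec_eq_PiM:
  "distr (\<Pi>\<^sub>M _\<in>(UNIV :: 'd::finite set). lborel) borel (\<lambda>y. \<chi> k. y k) = (lborel :: (real ^ 'd) measure)"
proof (rule lborel_eqI[symmetric])
  let ?P = "\<Pi>\<^sub>M _\<in>(UNIV :: 'd set). lborel :: real measure"
  note [measurable] = measurable_vec_lambda_PiM[where 'd='d]
  fix l u :: "real ^ 'd" assume le: "\<And>b. b \<in> Basis \<Longrightarrow> l \<bullet> b \<le> u \<bullet> b"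
  have lu: "l $ k \<le> u $ k" for k
    using le[of "axis k 1"] by (simp add: axis_in_Basis_iff inner_axis)
  have B: "Basis = (\<lambda>k :: 'd. axis k (1 :: real)) ` UNIV" by (auto simp: Basis_vec_def)
  have inj: "inj (\<lambda>k :: 'd. axis k (1 :: real))" by (auto simp: inj_on_def axis_eq_axis)
  have "(\<lambda>y. \<chi> k. y k) -` box l u \<inter> space ?P = (\<Pi>\<^sub>E k\<in>UNIV. {l $ k <..< u $ k})"
    by (auto simp: mem_box_cart space_PiM PiE_def Pi_iff)
  then have "emeasure (distr ?P borel (\<lambda>y. \<chi> k. y k)) (box l u) = emeasure ?P (\<Pi>\<^sub>E k\<in>UNIV. {l $ k <..< u $ k})"
    by (subst emeasure_distr) auto
  also have "\<dots> = (\<Prod>k\<in>UNIV. emeasure lborel {l $ k <..< u $ k})"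
    by (rule lborel_product.emeasure_PiM) auto
  also have "\<dots> = (\<Prod>k\<in>UNIV. ennreal (u $ k - l $ k))"
    using lu by simp
  also have "\<dots> = ennreal (\<Prod>k\<in>UNIV. u $ k - l $ k)"
    using lu by (intro prod_ennreal) simp
  also have "(\<Prod>k\<in>UNIV. u $ k - l $ k) = (\<Prod>b\<in>Basis. (u - l) \<bullet> b)"
    unfolding B by (subst prod.reindex[OF inj]) (simp add: inner_axis)
  finally show "emeasure (distr ?P borel (\<lambda>y. \<chi> k. y k)) (box l u) = ennreal (\<Prod>b\<in>Basis. (u - l) \<bullet> b)" .
qed simp

lemma borel_version:
  fixes h :: "'a::euclidean_space \<Rightarrow> real"
  assumes "h \<in> borel_measurable lebesgue"
  obtains h' M where "h' \<in> borel_measurable borel" "M \<in> null_sets lborel" "\<And>x. x \<notin> M \<Longrightarrow> h x = h' x"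
proof -
  obtain h' where h': "h' \<in> borel_measurable lborel" and ae: "AE x in lborel. h x = h' x"
    using completion_ex_borel_measurable_real[OF assms] by blast
  from ae obtain M where "M \<in> null_sets lborel" "\<And>x. x \<notin> M \<Longrightarrow> h x = h' x"
    by (rule AE_E3) auto
  with h' show thesis by (intro that[of h' M]) auto
qed

text \<open>Joins the pointwise inequality to the induction on coordinates. The former concerns
  Lebesgue measurable functions and exempts a null set for every argument; the latter wants
  measurability on the product space and allows exceptions at the barycentre only.\<close>

lemma power_mean_ratio_countable_range:
  fixes f g :: "'m::finite \<Rightarrow> real ^ 'd::finite \<Rightarrow> real"
  assumes w: "weight lam" and p: "p \<le> ereal (1 / real CARD('d))" and c: "0 < c"
    and f: "\<And>i x. 0 \<le> f i x" "\<And>i. integrable lebesgue (f i)" "\<And>i. 0 < integral\<^sup>L lebesgue (f i)"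
    and g: "\<And>i x. 0 \<le> g i x" "\<And>i. integrable lebesgue (g i)"
    and ctb: "\<And>i. countable (range (f i))" "\<And>i. countable (range (g i))"
    and H: "AE x in lborel. (\<forall>i. 0 < f i (x $ i)) \<longrightarrow>
      c \<le> power_mean lam p (\<lambda>i. g i (bary lam x) / f i (x $ i))"
  shows "c \<le> power_mean lam (power_transform CARD('d) p)
    (\<lambda>i. integral\<^sup>L lebesgue (g i) / integral\<^sup>L lebesgue (f i))"
proof -
  let ?P = "\<Pi>\<^sub>M _\<in>(UNIV :: 'd set). lborel :: real measure"
  let ?T = "\<lambda>y. \<chi> k. y k :: real ^ 'd"
  note T[measurable] = measurable_vec_lambda_PiM[where 'd='d]
  define R where "R u v \<longleftrightarrow> (\<forall>i. 0 < v i) \<longrightarrow> c \<le> power_mean lam p (\<lambda>i. u i / v i)" for u v :: "'m \<Rightarrow> real"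
  have fm: "f i \<in> borel_measurable lebesgue" "g i \<in> borel_measurable lebesgue" for i
    using f(2) g(2) by auto
  have "AE x in lborel. R (\<lambda>i. g i (bary lam x)) (\<lambda>i. f i (x $ i))"
    using H by (simp add: R_def)
  from AE_imp_pointwise[OF w fm(1) ctb(1) fm(2) ctb(2) this]
  obtain N where N: "N \<in> null_sets lborel"
    "\<And>x. \<forall>i. x $ i \<notin> N \<Longrightarrow> bary lam x \<notin> N \<Longrightarrow> R (\<lambda>i. g i (bary lam x)) (\<lambda>i. f i (x $ i))"
    by auto
  have "\<exists>h M. h \<in> borel_measurable borel \<and> M \<in> null_sets lborel \<and> (\<forall>x. x \<notin> M \<longrightarrow> f i x = h x)" for i
    using borel_version[OF fm(1)[of i]] by metis
  then obtain fb Mf where fb: "\<And>i. fb i \<in> borel_measurable borel" "\<And>i. Mf i \<in> null_sets lborel" "\<And>i x. x \<notin> Mf i \<Longrightarrow> f i x = fb i x"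
    by metis
  have "\<exists>h M. h \<in> borel_measurable borel \<and> M \<in> null_sets lborel \<and> (\<forall>x. x \<notin> M \<longrightarrow> g i x = h x)" for i
    using borel_version[OF fm(2)[of i]] by metis
  then obtain gb Mg where gb: "\<And>i. gb i \<in> borel_measurable borel" "\<And>i. Mg i \<in> null_sets lborel" "\<And>i x. x \<notin> Mg i \<Longrightarrow> g i x = gb i x"
    by metis
  define N' where "N' = N \<union> ((\<Union>i. Mf i) \<union> (\<Union>i. Mg i))"
  have N': "N' \<in> null_sets lborel"
    unfolding N'_def using N(1) fb(2) gb(2) by (intro null_sets.Un null_sets.finite_UN) auto
  then have [measurable]: "N' \<in> sets borel" by auto
  \<comment> \<open>Vanishing on \<open>N'\<close> turns the conditions on the \<open>x $ i\<close>
    into a consequence of \<open>f' i > 0\<close>, so that only the barycentre must avoid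
    \<open>N'\<close>. It also makes the functions Borel, since off \<open>N'\<close> they agree
    with their Borel versions.\<close>
  define f' g' where "f' i x = (if x \<in> N' then 0 else f i x)" and "g' i x = (if x \<in> N' then 0 else g i x)" for i x
  have f'b: "f' i = (\<lambda>x. if x \<in> N' then 0 else fb i x)" and g'b: "g' i = (\<lambda>x. if x \<in> N' then 0 else gb i x)" for i
    unfolding f'_def g'_def by (auto simp: N'_def fb gb)
  have [measurable]: "f' i \<in> borel_measurable borel" "g' i \<in> borel_measurable borel" for i
    unfolding f'b g'b using fb(1) gb(1) by measurable
  have transfer: "integrable ?P (\<lambda>y. h' (?T y))" "(\<integral>y. h' (?T y) \<partial>?P) = integral\<^sup>L lebesgue h"
    if h: "integrable lebesgue h" and h'[measurable]: "h' \<in> borel_measurable borel" and eq: "\<And>x. x \<notin> N' \<Longrightarrow> h' x = h x"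
    for h h' :: "real ^ 'd \<Rightarrow> real"
  proof -
    have "AE x in lebesgue. h x = h' x"
      using AE_not_in[OF null_sets_completionI[OF N']] by eventually_elim (simp add: eq)
    moreover have "h' \<in> borel_measurable lebesgue" by (intro measurable_completion) simp
    ultimately have "integrable lebesgue h'" "integral\<^sup>L lebesgue h = integral\<^sup>L lebesgue h'"
      using h integrable_cong_AE[of h lebesgue h'] integral_cong_AE[of h lebesgue h'] by auto
    then have *: "integrable lborel h'" "integral\<^sup>L lebesgue h = integral\<^sup>L lborel h'"
      by (simp_all add: integrable_completion integral_completion)
    show "integrable ?P (\<lambda>y. h' (?T y))"
      using *(1) by (subst (asm) lborel_vec_eq_PiM[symmetric], subst (asm) integrable_distr_eq) auto
    show "(\<integral>y. h' (?T y) \<partial>?P) = integral\<^sup>L lebesgue h"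
    proof -
      have "integral\<^sup>L lborel h' = integral\<^sup>L (distr ?P borel ?T) h'" by (simp only: lborel_vec_eq_PiM)
      also have "\<dots> = (\<integral>y. h' (?T y) \<partial>?P)" by (rule integral_distr) auto
      finally show ?thesis using *(2) by simp
    qed
  qed
  note tf = transfer[OF f(2), of "f' _"] and tg = transfer[OF g(2), of "g' _"]
  have NT: "?T -` N' \<inter> space ?P \<in> null_sets ?P"
    using N' by (auto simp: null_sets_def emeasure_distr simp flip: lborel_vec_eq_PiM)
  obtain n where n: "CARD('d) = Suc n" by (metis zero_less_card_finite gr0_implies_Suc)
  have iter: "(power_transform 1 ^^ j) p \<le> 1" if "j < CARD('d)" for j
  proof (rule power_transform_iterate(2))
    have "ereal (1 / real CARD('d)) \<le> ereal (1 / real (Suc j))"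
      using that by (simp add: frac_le)
    then show "p \<le> ereal (1 / real (Suc j))" using p by (rule order.trans[rotated])
  qed
  have "c \<le> power_mean lam ((power_transform 1 ^^ CARD('d)) p)
    (\<lambda>i. (\<integral>y. g' i (?T y) \<partial>?P) / (\<integral>y. f' i (?T y) \<partial>?P))"
  proof (rule power_mean_ratio_PiM[OF finite w c iter _ _ _ _ _ NT])
    show "integrable ?P (\<lambda>y. f' i (?T y))" "integrable ?P (\<lambda>y. g' i (?T y))" for i
      by (rule tf(1) tg(1); simp add: f'_def g'_def)+
    show "0 < (\<integral>y. f' i (?T y) \<partial>?P)" for i
      using f(3)[of i] by (subst tf(2)[of i i]) (simp_all add: f'_def)
    show "0 \<le> f' i (?T y)" "0 \<le> g' i (?T y)" for i y
      using f(1) g(1) by (auto simp: f'_def g'_def)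
    fix x :: "'m \<Rightarrow> 'd \<Rightarrow> real" and z
    assume pos: "\<And>i. 0 < f' i (?T (x i))" and z: "z = (\<lambda>k\<in>UNIV. \<Sum>i\<in>UNIV. lam i * x i k)"
      and zN: "z \<notin> ?T -` N' \<inter> space ?P"
    define X :: "real ^ 'd ^ 'm" where "X = (\<chi> i. ?T (x i))"
    have bz: "bary lam X = ?T z" by (simp add: X_def bary_def z vec_eq_iff)
    have Xn: "X $ i \<notin> N'" for i using pos[of i] by (auto simp: f'_def X_def split: if_splits)
    have zn: "bary lam X \<notin> N'" using zN by (auto simp: bz space_PiM)
    have fX: "f' i (?T (x i)) = f i (X $ i)" for i using Xn[of i] by (simp add: f'_def X_def)
    have gX: "g' i (?T z) = g i (bary lam X)" for i using zn by (simp add: g'_def bz)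
    have "R (\<lambda>i. g i (bary lam X)) (\<lambda>i. f i (X $ i))"
      using Xn zn by (intro N(2)) (auto simp: N'_def)
    then show "c \<le> power_mean lam p (\<lambda>i. g' i (?T z) / f' i (?T (x i)))"
      using pos by (simp add: R_def fX gX)
  qed auto
  moreover have "(\<integral>y. g' i (?T y) \<partial>?P) = integral\<^sup>L lebesgue (g i)" "(\<integral>y. f' i (?T y) \<partial>?P) = integral\<^sup>L lebesgue (f i)" for i
    by (rule tf(2) tg(2); simp add: f'_def g'_def)+
  moreover have "(power_transform 1 ^^ CARD('d)) p = power_transform CARD('d) p"
    using power_transform_iterate(1)[of p n] p by (simp only: n)
  ultimately show ?thesis by simp
qed

text \<open>Zero is fixed and positive values stay positive, so rounding does not change the sets
  \<open>S(f_i)\<close> over which the infimum is taken.\<close>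

definition round_down :: "real \<Rightarrow> real \<Rightarrow> real" where
  "round_down b v = (if v \<le> 0 then 0 else b powr of_int \<lfloor>log b v\<rfloor>)"

definition round_up :: "real \<Rightarrow> real \<Rightarrow> real" where
  "round_up b v = (if v \<le> 0 then 0 else b powr of_int \<lceil>log b v\<rceil>)"

lemma countable_range_round:
  "countable (range (\<lambda>x. round_down b (h x)))" "countable (range (\<lambda>x. round_up b (h x)))"
proof -
  have c: "countable (insert 0 (range (\<lambda>k :: int. b powr of_int k)))" by simp
  show "countable (range (\<lambda>x. round_down b (h x)))" "countable (range (\<lambda>x. round_up b (h x)))"
    by (rule countable_subset[OF _ c]; auto simp: round_down_def round_up_def)+
qed

lemma measurable_round[measurable]:
  "round_down b \<in> borel_measurable borel" "round_up b \<in> borel_measurable borel"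
  unfolding round_down_def[abs_def] round_up_def[abs_def] log_def by measurable

lemma round_bounds:
  assumes b: "1 < b" and v: "0 \<le> v"
  shows "0 \<le> round_down b v" "round_down b v \<le> v" "v \<le> b * round_down b v" "0 < round_down b v \<longleftrightarrow> 0 < v"
    and "v \<le> round_up b v" "round_up b v \<le> b * v"
proof -
  have "round_down b v \<le> v \<and> v \<le> b * round_down b v \<and> v \<le> round_up b v \<and> round_up b v \<le> b * v"
  proof (cases "v = 0")
    case False
    then have v: "0 < v" using v by simp
    have e: "b powr log b v = v" using b v by simp
    have "b powr of_int \<lfloor>log b v\<rfloor> \<le> b powr log b v" using b by simp
    moreover have "b powr log b v \<le> b powr (1 + of_int \<lfloor>log b v\<rfloor>)" using b by (subst powr_le_cancel_iff) linarith+
    moreover have "b powr log b v \<le> b powr of_int \<lceil>log b v\<rceil>" using b by simp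
    moreover have "b powr of_int \<lceil>log b v\<rceil> \<le> b powr (1 + log b v)" using b by (subst powr_le_cancel_iff) linarith+
    ultimately show ?thesis
      using v b unfolding round_down_def round_up_def powr_add e by simp
  qed (simp add: round_down_def round_up_def)
  then show "round_down b v \<le> v" "v \<le> b * round_down b v" "v \<le> round_up b v" "round_up b v \<le> b * v" by auto
  show "0 \<le> round_down b v" "0 < round_down b v \<longleftrightarrow> 0 < v"
    using b by (auto simp: round_down_def)
qed

text \<open>Rounding \<open>f\<close> down and \<open>g\<close> up only increases the ratios, so the
  hypothesis survives. Each integral changes by a factor of at most \<open>b\<close>, which costs
  \<open>b\<^sup>2\<close> by homogeneity of the mean; then \<open>b\<close> tends to 1.\<close>

lemma power_mean_ratio_AE:
  fixes f g :: "'m::finite \<Rightarrow> real ^ 'd::finite \<Rightarrow> real"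
  assumes w: "weight lam" and p: "p \<le> ereal (1 / real CARD('d))" and c: "0 < c"
    and f: "\<And>i x. 0 \<le> f i x" "\<And>i. integrable lebesgue (f i)" "\<And>i. 0 < integral\<^sup>L lebesgue (f i)"
    and g: "\<And>i x. 0 \<le> g i x" "\<And>i. integrable lebesgue (g i)"
    and H: "AE x in lborel. (\<forall>i. 0 < f i (x $ i)) \<longrightarrow>
      c \<le> power_mean lam p (\<lambda>i. g i (bary lam x) / f i (x $ i))"
  shows "c \<le> power_mean lam (power_transform CARD('d) p)
    (\<lambda>i. integral\<^sup>L lebesgue (g i) / integral\<^sup>L lebesgue (f i))" (is "c \<le> ?R")
proof -
  have main: "c \<le> b\<^sup>2 * ?R" if b: "1 < b" for b
  proof -
    note rd = round_bounds[OF b f(1)] and ru = round_bounds[OF b g(1)]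
    define f' g' where "f' i x = round_down b (f i x)" and "g' i x = round_up b (g i x)" for i x
    have ru0: "0 \<le> g' i x" for i x using g(1)[of i x] ru(5)[of i x] unfolding g'_def by linarith
    have m: "f' i \<in> borel_measurable lebesgue" "g' i \<in> borel_measurable lebesgue" for i
      unfolding f'_def[abs_def] g'_def[abs_def]
      using measurable_compose[OF borel_measurable_integrable[OF f(2)[of i]] measurable_round(1)]
        measurable_compose[OF borel_measurable_integrable[OF g(2)[of i]] measurable_round(2)] by auto
    have int: "integrable lebesgue (f' i)" "integrable lebesgue (g' i)" for i
    proof -
      show "integrable lebesgue (f' i)"
        by (rule Bochner_Integration.integrable_bound[OF f(2)[of i] m(1)])
          (use rd f(1) in \<open>auto simp: f'_def abs_of_nonneg\<close>)
      have "integrable lebesgue (\<lambda>x. b * g i x)" using g(2) by simp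
      then show "integrable lebesgue (g' i)"
        by (rule Bochner_Integration.integrable_bound[OF _ m(2)])
          (use ru(6) ru0 g(1) b in \<open>auto simp: g'_def[symmetric] abs_of_nonneg abs_mult\<close>)
    qed
    have bf: "f i x \<le> b * f' i x" and bg: "g' i x \<le> b * g i x" for i x
      using rd(3) ru(6) by (simp_all add: f'_def g'_def)
    have If: "integral\<^sup>L lebesgue (f i) \<le> b * integral\<^sup>L lebesgue (f' i)" for i
      using integral_mono[OF f(2)[of i], of "\<lambda>x. b * f' i x"] int(1)[of i] bf by simp
    have Ig: "integral\<^sup>L lebesgue (g' i) \<le> b * integral\<^sup>L lebesgue (g i)" for i
      using integral_mono[OF int(2)[of i], of "\<lambda>x. b * g i x"] g(2)[of i] bg by simp
    have pf: "0 < integral\<^sup>L lebesgue (f' i)" for i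
      using If[of i] f(3)[of i] b by (smt (verit) mult_nonneg_nonpos)
    have g0: "0 \<le> integral\<^sup>L lebesgue (g i)" for i using g by simp
    have "c \<le> power_mean lam (power_transform CARD('d) p)
      (\<lambda>i. integral\<^sup>L lebesgue (g' i) / integral\<^sup>L lebesgue (f' i))"
    proof (rule power_mean_ratio_countable_range[OF w p c _ int(1) pf ru0 int(2)])
      show "0 \<le> f' i x" for i x using rd(1) by (simp add: f'_def)
      show "countable (range (f' i))" "countable (range (g' i))" for i
        unfolding f'_def[abs_def] g'_def[abs_def] by (rule countable_range_round)+
      show "AE x in lborel. (\<forall>i. 0 < f' i (x $ i)) \<longrightarrow>
        c \<le> power_mean lam p (\<lambda>i. g' i (bary lam x) / f' i (x $ i))"
        using H
      proof (rule eventually_mono, intro impI)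
        fix x :: "real ^ 'd ^ 'm"
        assume *: "(\<forall>i. 0 < f i (x $ i)) \<longrightarrow> c \<le> power_mean lam p (\<lambda>i. g i (bary lam x) / f i (x $ i))"
          and pos: "\<forall>i. 0 < f' i (x $ i)"
        then have pos': "0 < f i (x $ i)" for i using rd(4) by (simp add: f'_def)
        with * have "c \<le> power_mean lam p (\<lambda>i. g i (bary lam x) / f i (x $ i))" by blast
        also have "\<dots> \<le> power_mean lam p (\<lambda>i. g' i (bary lam x) / f' i (x $ i))"
        proof (rule power_mean_mono[OF w])
          fix i
          show "0 \<le> g i (bary lam x) / f i (x $ i)" using f(1) g(1) by simp
          show "g i (bary lam x) / f i (x $ i) \<le> g' i (bary lam x) / f' i (x $ i)"
            using pos ru(5) rd(2) g(1) ru0 by (intro frac_le) (auto simp: f'_def g'_def)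
        qed
        finally show "c \<le> power_mean lam p (\<lambda>i. g' i (bary lam x) / f' i (x $ i))" .
      qed
    qed
    also have "\<dots> \<le> power_mean lam (power_transform CARD('d) p)
      (\<lambda>i. b\<^sup>2 * (integral\<^sup>L lebesgue (g i) / integral\<^sup>L lebesgue (f i)))"
    proof (rule power_mean_mono[OF w])
      fix i
      show "0 \<le> integral\<^sup>L lebesgue (g' i) / integral\<^sup>L lebesgue (f' i)"
        using ru0 pf[of i] by simp
      have "integral\<^sup>L lebesgue (g' i) / integral\<^sup>L lebesgue (f' i)
        \<le> (b * integral\<^sup>L lebesgue (g i)) / (integral\<^sup>L lebesgue (f i) / b)"
        using Ig[of i] If[of i] f(3)[of i] g0[of i] b by (intro frac_le) (auto simp: field_simps)
      then show "integral\<^sup>L lebesgue (g' i) / integral\<^sup>L lebesgue (f' i)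
        \<le> b\<^sup>2 * (integral\<^sup>L lebesgue (g i) / integral\<^sup>L lebesgue (f i))"
        by (simp add: power2_eq_square mult_ac)
    qed
    also have "\<dots> = b\<^sup>2 * ?R" using b by (intro power_mean_scale[OF w]) simp
    finally show ?thesis .
  qed
  have "((\<lambda>b. b\<^sup>2 * ?R) \<longlongrightarrow> 1\<^sup>2 * ?R) (at_right 1)" by (intro tendsto_intros)
  moreover have "\<forall>\<^sub>F b in at_right 1. c \<le> b\<^sup>2 * ?R"
    using main by (simp add: eventually_at_filter)
  ultimately have "c \<le> 1\<^sup>2 * ?R"
    by (intro tendsto_lowerbound) auto
  then show ?thesis by simp
qed

section \<open>The least constant\<close>

lemma sets_lebesgue_pos_prod:
  fixes f :: "'m::finite \<Rightarrow> real ^ 'd \<Rightarrow> real"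
  assumes "\<And>i. f i \<in> borel_measurable lebesgue"
  shows "pos_prod f \<in> sets lebesgue"
proof -
  have "pos_prod f = (\<Inter>i. (\<lambda>x. x $ i) -` {x. f i x \<in> {0<..}} \<inter> space lebesgue)"
    by (auto simp: pos_prod_def pos_set_def)
  also have "\<dots> \<in> sets lebesgue"
    using assms by (intro sets.finite_INT measurable_sets[OF lebesgue_measurable_nth] lebesgue_measurable_vimage_borel) auto
  finally show ?thesis .
qed

theorem mainTheorem6:
  fixes lam :: "'m::finite \<Rightarrow> real" and p :: ereal
  assumes "weight lam"
    and "p \<le> ereal (1 / real CARD('d::finite))"
  shows "is_least
    {C :: real. \<forall>(f :: 'm \<Rightarrow> real ^ 'd \<Rightarrow> real) (g :: 'm \<Rightarrow> real ^ 'd \<Rightarrow> real).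
       (\<forall>i x. 0 \<le> f i x) \<longrightarrow> (\<forall>i x. 0 \<le> g i x) \<longrightarrow>
       (\<forall>i. integrable lebesgue (f i)) \<longrightarrow> (\<forall>i. integrable lebesgue (g i)) \<longrightarrow>
       (\<forall>i. 0 < L1_norm (f i)) \<longrightarrow>
       ess_inf (lebesgue_on (pos_prod f))
         (\<lambda>x. ereal (power_mean lam p (\<lambda>i. g i (bary lam x) / f i (x $ i))))
       \<le> ereal (C * power_mean lam (power_transform CARD('d) p)
                      (\<lambda>i. L1_norm (g i) / L1_norm (f i)))}
    1"
  unfolding is_least_def Ball_def mem_Collect_eq
proof (intro conjI allI ballI impI)
  fix f g :: "'m \<Rightarrow> real ^ 'd \<Rightarrow> real"
  assume f0: "\<forall>i x. 0 \<le> f i x" and g0: "\<forall>i x. 0 \<le> g i x"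
    and fi: "\<forall>i. integrable lebesgue (f i)" and gi: "\<forall>i. integrable lebesgue (g i)"
    and f1: "\<forall>i. 0 < L1_norm (f i)"
  have L: "L1_norm (f i) = integral\<^sup>L lebesgue (f i)" "L1_norm (g i) = integral\<^sup>L lebesgue (g i)" for i
    using f0 g0 by (simp_all add: L1_norm_def)
  let ?R = "power_mean lam (power_transform CARD('d) p) (\<lambda>i. L1_norm (g i) / L1_norm (f i))"
  \<comment> \<open>Measurability of \<open>S\<close> turns an almost-everywhere statement on the
    restricted measure into an implication almost everywhere on the whole space.\<close>
  have S: "pos_prod f \<in> sets lebesgue"
    using fi by (intro sets_lebesgue_pos_prod) auto
  have R0: "0 \<le> ?R" using f0 g0 by (intro power_mean_nonneg) (simp add: L)
  show "ess_inf (lebesgue_on (pos_prod f))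
      (\<lambda>x. ereal (power_mean lam p (\<lambda>i. g i (bary lam x) / f i (x $ i)))) \<le> ereal (1 * ?R)"
    unfolding ess_inf_def
  proof (rule Sup_least, rule dense_le)
    \<comment> \<open>Passing to \<open>y < c\<close> makes the bound real once it is positive, even
      if \<open>c\<close> is infinite; for \<open>y \<le> 0\<close> nonnegativity of the mean
      suffices.\<close>
    fix c y assume c: "c \<in> {c. AE x in lebesgue_on (pos_prod f).
      c \<le> ereal (power_mean lam p (\<lambda>i. g i (bary lam x) / f i (x $ i)))}" and "y < c"
    show "y \<le> ereal (1 * ?R)"
    proof (cases "0 < y")
      case True
      then obtain r where r: "y = ereal r" "0 < r" using \<open>y < c\<close> by (cases y) auto
      from c have "AE x in lebesgue. x \<in> pos_prod f \<longrightarrow>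
        c \<le> ereal (power_mean lam p (\<lambda>i. g i (bary lam x) / f i (x $ i)))"
        using S by (subst (asm) mem_Collect_eq, subst (asm) AE_restrict_space_iff) auto
      then have "AE x in lborel. (\<forall>i. 0 < f i (x $ i)) \<longrightarrow>
        r \<le> power_mean lam p (\<lambda>i. g i (bary lam x) / f i (x $ i))"
        unfolding AE_completion_iff
      proof (rule eventually_mono, intro impI)
        fix x assume "x \<in> pos_prod f \<longrightarrow> c \<le> ereal (power_mean lam p (\<lambda>i. g i (bary lam x) / f i (x $ i)))"
          and "\<forall>i. 0 < f i (x $ i)"
        then have "c \<le> ereal (power_mean lam p (\<lambda>i. g i (bary lam x) / f i (x $ i)))"
          by (simp add: pos_prod_def pos_set_def)
        with \<open>y < c\<close> have "y \<le> ereal (power_mean lam p (\<lambda>i. g i (bary lam x) / f i (x $ i)))"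
          by (meson less_imp_le order.trans)
        then show "r \<le> power_mean lam p (\<lambda>i. g i (bary lam x) / f i (x $ i))" by (simp add: r)
      qed
      then have "r \<le> ?R"
        unfolding L using f0 g0 fi gi f1
        by (intro power_mean_ratio_AE[OF assms r(2)]) (auto simp: L)
      then show ?thesis by (simp add: r)
    next
      case False
      then show ?thesis using R0 by (metis ereal_less_eq(5) mult_1 not_less order.trans)
    qed
  qed
next
  fix C :: real
  let ?E = "\<lambda>f g. ess_inf (lebesgue_on (pos_prod f))
    (\<lambda>x. ereal (power_mean lam p (\<lambda>i. g i (bary lam x) / f i (x $ i))))"
  let ?R = "\<lambda>f g. power_mean lam (power_transform CARD('d) p) (\<lambda>i. L1_norm (g i) / L1_norm (f i))"
  assume C: "\<forall>(f :: 'm \<Rightarrow> real ^ 'd \<Rightarrow> real) (g :: 'm \<Rightarrow> real ^ 'd \<Rightarrow> real).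
    (\<forall>i x. 0 \<le> f i x) \<longrightarrow> (\<forall>i x. 0 \<le> g i x) \<longrightarrow>
    (\<forall>i. integrable lebesgue (f i)) \<longrightarrow> (\<forall>i. integrable lebesgue (g i)) \<longrightarrow>
    (\<forall>i. 0 < L1_norm (f i)) \<longrightarrow> ?E f g \<le> ereal (C * ?R f g)"
  \<comment> \<open>When all functions are the indicator of one convex set, the barycentre stays in
    that set and every ratio is 1. Then the essential infimum is at least 1 and the right side is
    \<open>C\<close>.\<close>
  define u :: "real ^ 'd \<Rightarrow> real" where "u = indicator (ball 0 1)"
  have u0: "0 \<le> u x" for x by (simp add: u_def)
  have int: "integrable lebesgue u"
    unfolding u_def by (simp flip: lmeasurable_iff_integrable)
  have L: "L1_norm u = measure lebesgue (ball (0 :: real ^ 'd) 1)"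
    by (simp add: u_def L1_norm_def)
  have L0: "0 < L1_norm u" by (simp add: L content_ball_pos)
  have "1 \<le> ?E (\<lambda>_. u) (\<lambda>_. u)"
    unfolding ess_inf_def
  proof (intro Sup_upper CollectI AE_I2)
    fix x :: "real ^ 'd ^ 'm" assume "x \<in> space (lebesgue_on (pos_prod (\<lambda>_. u)))"
    then have x: "x $ i \<in> ball 0 1" for i
      by (auto simp: pos_prod_def pos_set_def u_def indicator_def split: if_splits)
    have "bary lam x \<in> ball 0 1"
      unfolding bary_def using x weight_nonneg[OF assms(1)] weight_sum[OF assms(1)]
      by (intro convex_sum convex_ball) auto
    then have "(\<lambda>i. u (bary lam x) / u (x $ i)) = (\<lambda>_. 1)"
      using x by (simp add: u_def)
    then show "1 \<le> ereal (power_mean lam p (\<lambda>i. u (bary lam x) / u (x $ i)))"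
      by (simp add: power_mean_one[OF assms(1)])
  qed
  also have "\<dots> \<le> ereal (C * ?R (\<lambda>_. u) (\<lambda>_. u))"
    using C[rule_format, of "\<lambda>_. u" "\<lambda>_. u"] int L0 u0 by simp
  also have "\<dots> = ereal C"
    using L0 by (simp add: power_mean_one[OF assms(1)])
  finally show "1 \<le> C" by simp
qed

end
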